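(* There exist a bivariate polynomial $q$ and a constant $C$ such that the following holds for every prime $p$ and all integers $m,n\ge 1$. Let $\mathbf{A}\in\mathbb{F}_p^{m\times n}$ and $\mathbf{b}\in\mathbb{F}_p^m$, and let $w$ be the maximum number of non-zero components of the rows of $\mathbf{A}$. If the system $\mathbf{A}\mathbf{x}=\mathbf{b}$ is unsatisfiable in the field $\mathbb{F}_p$ with $p$ elements, then $\mathcal{S}(\mathbf{A},\mathbf{b})\cup\mathcal{Z}$ has a (not necessarily tree-like) semi-algebraic refutation of size at most $q(n,p^w)$ (i.e. size polynomial in $n$ and $p^w$) and degree at most $C\cdot w+C$ (i.e. degree linear in $w$).
   Context: **Semi-algebraic proofs.** For a given finite set of formal variables, proofs manipulate inequalities $P\ge 0$, where $P$ is a polynomial in these variables with rational coefficients. A proof from a set of hypotheses (polynomial inequalities) is a finite sequence of inequalities, each of which is a hypothesis, or an axiom, or follows from earlier ones in the sequence by an inference rule. - Axioms, for each variable $v$: $v\ge 0$, $\;1-v\ge 0$, $\;v^2-v\ge 0$, $\;v-v^2\ge 0$. - Positive linear combination: from $P\ge 0$ and $Q\ge 0$ infer $a\cdot P+b\cdot Q\ge 0$, for non-negative rationals $a,b$. - Multiplication (lifting) rules, for each variable $v$: from $P\ge 0$ infer $P\cdot v\ge 0$; from $P\ge 0$ infer $P\cdot(1-v)\ge 0$. Polynomials are identified when they are equal as formal polynomials. An inequality $P\ge Q$ means $P-Q\ge 0$; an equation $P=Q$ means the pair of inequalities $P-Q\ge 0$ and $Q-P\ge 0$. A refutation of a set of hypotheses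 is a proof of $-1\ge 0$ from it. Derived inequalities may be used several times as hypotheses of rules (a proof is called tree-like if every derived inequality is used at most once). **Measures.** The degree of a proof is the maximum total degree of the polynomials appearing in it. The size of a polynomial is the sum of the degrees of its monomials. The size of a proof is the sum of the sizes of the polynomials that appear in it. **Encoding of linear equations over $\mathbb{F}_p$.** Elements of $\mathbb{F}_p$ are identified with the integers $\{0,\dots,p-1\}$, and $[n]=\{1,\dots,n\}$. The formal variables of the proof system are $x_i(\ell)$ for $i\in[n]$ and $\ell\in\{0,\dots,p-1\}$; the vector $\mathbf{x}_i=(x_i(0),\dots,x_i(p-1))$ is thought of as the indicator vector of the value in $\mathbb{F}_p$ of the $i$-th unknown. Let $\mathcal{Z}$ be the set of equations $x_i(0)+\cdots+x_i(p-1)=1$ for $i\in[n]$. For $\mathbf{a}=(a_1,\dots,a_n)\in\mathbb{F}_p^n$ and $b\in\mathbb{F}_p$, let $I=\mathrm{supp}(\mathbf{a})=\{i\in[n]:a_i\neq 0\}$. Then $\mathcal{S}(\mathbf{a},b)$ is the set of inequalities $$\sum_{i\in I}(1-x_i(z_i))\ \ge\ 1\qquad\text{for all } \mathbf{z}=(z_i)_{i\in I}\in\mathbb{F}_p^I \text{ with } \sum_{i\in I}a_iz_i\not\equiv b \bmod p.$$ For a system $\mathbf{A}\mathbf{x}=\mathbf{b}$ with rows $\mathbf{a}_1,\dots,\mathbf{a}_m$ of $\mathbf{A}$ and $\mathbf{b}=(b_1,\dots,b_m)$, let $\mathcal{S}(\mathbf{A},\mathbf{b})=\bigcup_{i=1}^m\mathcal{S}(\mathbf{a}_i,b_i)$.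 *)

theory Defs
  imports
    "HOL-Library.Poly_Mapping"
    "HOL-Library.FuncSet"
    "HOL-Computational_Algebra.Polynomial"
    "HOL-Computational_Algebra.Primes"
    "HOL-Number_Theory.Cong"
begin

section \<open>Formal polynomials with rational coefficients\<close>

text \<open>
  A monomial maps each variable to its exponent; a polynomial maps each monomial to its
  coefficient. Both have finite support, so equality on this type is equality of formal
  polynomials, and the ring operations are those of the polynomial ring.
\<close>

type_synonym 'v monomial = "'v \<Rightarrow>\<^sub>0 nat"
type_synonym 'v rpoly = "'v monomial \<Rightarrow>\<^sub>0 rat"

definition Const :: "rat \<Rightarrow> 'v rpoly" where
  "Const c = Poly_Mapping.single 0 c"

definition Var :: "'v \<Rightarrow> 'v rpoly" where
  "Var v = Poly_Mapping.single (Poly_Mapping.single v 1) 1"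

definition monomial_degree :: "'v monomial \<Rightarrow> nat" where
  "monomial_degree u = (\<Sum>v\<in>Poly_Mapping.keys u. Poly_Mapping.lookup u v)"

definition total_degree :: "'v rpoly \<Rightarrow> nat" where
  "total_degree P = Max (insert 0 (monomial_degree ` Poly_Mapping.keys P))"

definition poly_size :: "'v rpoly \<Rightarrow> nat" where
  "poly_size P = (\<Sum>u\<in>Poly_Mapping.keys P. monomial_degree u)"


section \<open>Semi-algebraic proofs\<close>

text \<open>
  The polynomial \<open>P\<close> stands for the inequality \<open>P \<ge> 0\<close>. The parameter \<open>V\<close> is the set of
  formal variables of the proof system.
\<close>

definition sa_axioms :: "'v set \<Rightarrow> 'v rpoly set" where
  "sa_axioms V = (\<Union>v\<in>V. {Var v, 1 - Var v, (Var v)^2 - Var v, Var v - (Var v)^2})"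

text \<open>\<open>sa_infers V \<Gamma> R\<close>: one inference rule derives \<open>R\<close> from premises in \<open>\<Gamma>\<close>.\<close>

inductive sa_infers :: "'v set \<Rightarrow> 'v rpoly set \<Rightarrow> 'v rpoly \<Rightarrow> bool"
  for V :: "'v set" and \<Gamma> :: "'v rpoly set" where
  lin_comb: "P \<in> \<Gamma> \<Longrightarrow> Q \<in> \<Gamma> \<Longrightarrow> 0 \<le> a \<Longrightarrow> 0 \<le> b \<Longrightarrow>
    sa_infers V \<Gamma> (Const a * P + Const b * Q)"
| mult_var: "P \<in> \<Gamma> \<Longrightarrow> v \<in> V \<Longrightarrow> sa_infers V \<Gamma> (P * Var v)"
| mult_co_var: "P \<in> \<Gamma> \<Longrightarrow> v \<in> V \<Longrightarrow> sa_infers V \<Gamma> (P * (1 - Var v))"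

definition sa_proof :: "'v set \<Rightarrow> 'v rpoly set \<Rightarrow> 'v rpoly list \<Rightarrow> bool" where
  "sa_proof V H \<pi> \<longleftrightarrow>
     (\<forall>k<length \<pi>. \<pi> ! k \<in> H \<or> \<pi> ! k \<in> sa_axioms V \<or> sa_infers V (set (take k \<pi>)) (\<pi> ! k))"

definition sa_refutation :: "'v set \<Rightarrow> 'v rpoly set \<Rightarrow> 'v rpoly list \<Rightarrow> bool" where
  "sa_refutation V H \<pi> \<longleftrightarrow> sa_proof V H \<pi> \<and> \<pi> \<noteq> [] \<and> last \<pi> = - 1"

definition proof_degree :: "'v rpoly list \<Rightarrow> nat" where
  "proof_degree \<pi> = Max (insert 0 (total_degree ` set \<pi>))"

definition proof_size :: "'v rpoly list \<Rightarrow> nat" where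
  "proof_size \<pi> = (\<Sum>P\<leftarrow>\<pi>. poly_size P)"


section \<open>Encoding of linear equations over the field with \<open>p\<close> elements\<close>

text \<open>
  Field elements are represented by \<open>{..<p}\<close>, with arithmetic modulo \<open>p\<close>. A row is a function
  on \<open>{1..n}\<close> and a matrix a function on \<open>{1..m}\<close> (row index first); values outside these
  ranges are irrelevant. The variable \<open>x\<^sub>i(l)\<close> is the pair \<open>(i, l)\<close>.
\<close>

type_synonym enc_var = "nat \<times> nat"

definition enc_vars :: "nat \<Rightarrow> nat \<Rightarrow> enc_var set" where
  "enc_vars p n = {1..n} \<times> {..<p}"

definition row_supp :: "nat \<Rightarrow> (nat \<Rightarrow> nat) \<Rightarrow> nat set" where
  "row_supp n a = {i \<in> {1..n}. a i \<noteq> 0}"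

text \<open>
  The inequality \<open>P \<ge> Q\<close> is represented by \<open>P - Q\<close>, and the equation \<open>P = Q\<close> by both
  \<open>P - Q\<close> and \<open>Q - P\<close>.
\<close>

definition enc_Z :: "nat \<Rightarrow> nat \<Rightarrow> enc_var rpoly set" where
  "enc_Z p n = (\<Union>i\<in>{1..n}. {(\<Sum>l<p. Var (i, l)) - 1, 1 - (\<Sum>l<p. Var (i, l))})"

definition enc_row :: "nat \<Rightarrow> nat \<Rightarrow> (nat \<Rightarrow> nat) \<Rightarrow> nat \<Rightarrow> enc_var rpoly set" where
  "enc_row p n a b =
     {(\<Sum>i\<in>row_supp n a. 1 - Var (i, z i)) - 1 | z.
        z \<in> row_supp n a \<rightarrow>\<^sub>E {..<p} \<and> \<not> [(\<Sum>i\<in>row_supp n a. a i * z i) = b] (mod p)}"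

definition enc_system ::
    "nat \<Rightarrow> nat \<Rightarrow> nat \<Rightarrow> (nat \<Rightarrow> nat \<Rightarrow> nat) \<Rightarrow> (nat \<Rightarrow> nat) \<Rightarrow> enc_var rpoly set" where
  "enc_system p m n A b = (\<Union>j\<in>{1..m}. enc_row p n (A j) (b j))"

definition lin_satisfiable ::
    "nat \<Rightarrow> nat \<Rightarrow> nat \<Rightarrow> (nat \<Rightarrow> nat \<Rightarrow> nat) \<Rightarrow> (nat \<Rightarrow> nat) \<Rightarrow> bool" where
  "lin_satisfiable p m n A b \<longleftrightarrow>
     (\<exists>x. (\<forall>i\<in>{1..n}. x i < p) \<and> (\<forall>j\<in>{1..m}. [(\<Sum>i=1..n. A j i * x i) = b j] (mod p)))"

definition max_row_weight :: "nat \<Rightarrow> nat \<Rightarrow> (nat \<Rightarrow> nat \<Rightarrow> nat) \<Rightarrow> nat" where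
  "max_row_weight m n A = Max ((\<lambda>j. card (row_supp n (A j))) ` {1..m})"


section \<open>Bivariate polynomials\<close>

text \<open>
  A bivariate polynomial is a polynomial in the second variable whose coefficients are
  polynomials in the first variable.
\<close>

definition bipoly_eval :: "real poly poly \<Rightarrow> real \<Rightarrow> real \<Rightarrow> real" where
  "bipoly_eval q x y = poly (poly q [:y:]) x"

end

theory Submission
  imports Defs
begin

text \<open>
  Write \<open>X\<^sub>i\<close> for the sum of all \<open>l x\<^sub>i(l)\<close>. By Gaussian elimination there are
  at most \<open>n + 1\<close> rows and multipliers \<open>y\<^sub>j\<close> such that the sum of the
  \<open>y\<^sub>j (a\<^sub>j X - b\<^sub>j) / p\<close> is an integer combination of the \<open>X\<^sub>i\<close> plus a
  non-integer constant. Starting from \<open>0\<close>, these row forms and then the terms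
  \<open>- k\<^sub>i X\<^sub>i\<close> that cancel the combination are added one at a time. For each partial sum
  \<open>M\<close> and all integers \<open>k\<close> of polynomially bounded absolute value, one derives
  \<open>(M + k)(M + k - 1) \<ge> 0\<close>, which says that \<open>M\<close> is an integer. Each step adds a form in
  at most \<open>w\<close> unknowns, so it is a case distinction over at most \<open>p^w\<close> assignments: in
  each, the added form is an integer or the assignment is excluded by a hypothesis. The last
  partial sum is the non-integer constant, for which one of the inequalities is false.
\<close>

section \<open>Monomial counts and degrees\<close>

text \<open>The obstacle is density: elimination modulo p produces equations that may involve all n
  unknowns, and a case distinction over their assignments is exponential in n. Dividing by p and
  passing to integer-valued rational forms avoids this. Integrality of a form is stated by quadratic
  inequalities with at most \<open>(n * p + 1)^2\<close> monomials, however many unknowns the form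
  involves, and only the newly added sparse form is split into cases. The price is the range of k.
  If the added form takes integer values of absolute value at most r, then shifts of the new sum up
  to R need shifts of the old sum up to R + r. The range therefore starts wide and shrinks by r at
  both ends with every step. Reducing the multipliers modulo p makes r = (n + 1) p^2 sufficient, so
  the initial range stays polynomial. Using at most n + 1 rows matters because the size bound must
  not depend on m.\<close>

abbreviation mons :: "'v rpoly \<Rightarrow> nat" where
  "mons P \<equiv> card (Poly_Mapping.keys P)"

text \<open>The restriction to \<open>V\<close> is what lets a member act as a multiplier: its
  monomials can be built by the lifting rules, which exist only for variables in
  \<open>V\<close>.\<close>

definition polys :: "'v set \<Rightarrow> nat \<Rightarrow> 'v rpoly set" where
  "polys V d = {P. \<forall>u\<in>Poly_Mapping.keys P. Poly_Mapping.keys u \<subseteq> V \<and> monomial_degree u \<le> d}"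

lemma monomial_degree_superset:
  "finite A \<Longrightarrow> Poly_Mapping.keys u \<subseteq> A \<Longrightarrow>
    monomial_degree u = (\<Sum>v\<in>A. Poly_Mapping.lookup u v)"
  unfolding monomial_degree_def
  by (rule sum.mono_neutral_left) (auto simp: in_keys_iff)

lemma monomial_degree_0 [simp]: "monomial_degree 0 = 0"
  by (simp add: monomial_degree_def)

lemma monomial_degree_single [simp]: "monomial_degree (Poly_Mapping.single v k) = k"
  by (simp add: monomial_degree_def)

lemma monomial_degree_add: "monomial_degree (u + u') = monomial_degree u + monomial_degree u'"
proof -
  let ?A = "Poly_Mapping.keys u \<union> Poly_Mapping.keys u'"
  have "Poly_Mapping.keys (u + u') \<subseteq> ?A"
    by (rule Poly_Mapping.keys_add)
  then show ?thesis
    by (simp add: monomial_degree_superset[of ?A] lookup_add sum.distrib)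
qed

lemma monomial_degree_sum: "monomial_degree (sum f A) = (\<Sum>a\<in>A. monomial_degree (f a))"
  by (induction A rule: infinite_finite_induct) (simp_all add: monomial_degree_add)

lemma keys_mult_image:
  "Poly_Mapping.keys (P * Q) \<subseteq> (\<lambda>(u, u'). u + u') ` (Poly_Mapping.keys P \<times> Poly_Mapping.keys Q)"
  using keys_mult[of P Q] by auto

lemma mons_mult: "mons (P * Q) \<le> mons P * mons Q"
proof -
  have "mons (P * Q) \<le> card ((\<lambda>(u, u'). u + u') ` (Poly_Mapping.keys P \<times> Poly_Mapping.keys Q))"
    by (intro card_mono keys_mult_image) simp
  also have "\<dots> \<le> card (Poly_Mapping.keys P \<times> Poly_Mapping.keys Q)"
    by (intro card_image_le) simp
  finally show ?thesis
    by (simp add: card_cartesian_product)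
qed

lemma mons_add: "mons (P + Q) \<le> mons P + mons Q"
  by (meson Poly_Mapping.keys_add card_Un_le card_mono finite_UnI finite_keys order.trans)

lemma mons_single_mult: "mons (Poly_Mapping.single u a * P) \<le> mons P"
  using mons_mult[of "Poly_Mapping.single u a" P] by (simp split: if_splits)

lemma mons_diff: "mons (P - Q) \<le> mons P + mons Q"
  using mons_add[of P "- Q"] by simp

lemma mons_sum: "(\<And>a. a \<in> A \<Longrightarrow> mons (f a) \<le> k) \<Longrightarrow> mons (sum f A) \<le> card A * k"
proof (induction A rule: infinite_finite_induct)
  case (insert a A)
  then show ?case
    using mons_add[of "f a" "sum f A"] by (simp add: add_mono order.trans)
qed simp_all

lemma mons_Const: "mons (Const c) \<le> 1"
  by (simp add: Const_def)

lemma mons_Var: "mons (Var v) \<le> 1"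
  by (simp add: Var_def)

section \<open>Polynomials of bounded degree over a fixed set of variables\<close>

lemma polys_mono: "d \<le> d' \<Longrightarrow> polys V d \<subseteq> polys V d'"
  by (force simp: polys_def)

lemma polys_0 [simp]: "0 \<in> polys V d"
  by (simp add: polys_def)

lemma polys_1 [simp]: "1 \<in> polys V d"
  by (simp add: polys_def)

lemma polys_single:
  "Poly_Mapping.keys u \<subseteq> V \<Longrightarrow> monomial_degree u \<le> d \<Longrightarrow> Poly_Mapping.single u a \<in> polys V d"
  by (simp add: polys_def)

lemma polys_Const [simp]: "Const c \<in> polys V d"
  by (simp add: Const_def polys_single)

lemma polys_Var: "v \<in> V \<Longrightarrow> 1 \<le> d \<Longrightarrow> Var v \<in> polys V d"
  by (simp add: Var_def polys_single)

lemma polys_add: "P \<in> polys V d \<Longrightarrow> Q \<in> polys V d \<Longrightarrow> P + Q \<in> polys V d"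
  using Poly_Mapping.keys_add[of P Q] by (auto simp: polys_def)

lemma polys_uminus: "P \<in> polys V d \<Longrightarrow> - P \<in> polys V d"
  by (simp add: polys_def)

lemma polys_diff: "P \<in> polys V d \<Longrightarrow> Q \<in> polys V d \<Longrightarrow> P - Q \<in> polys V d"
  using polys_add[of P V d "- Q"] by (simp add: polys_uminus)

lemma polys_mult:
  assumes "P \<in> polys V d" "Q \<in> polys V e"
  shows "P * Q \<in> polys V (d + e)"
proof -
  have "Poly_Mapping.keys w \<subseteq> V \<and> monomial_degree w \<le> d + e" if w: "w \<in> Poly_Mapping.keys (P * Q)" for w
  proof -
    obtain u u' where u: "u \<in> Poly_Mapping.keys P" "u' \<in> Poly_Mapping.keys Q" "w = u + u'"
      using subsetD[OF keys_mult_image w] by auto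
    have "Poly_Mapping.keys u \<union> Poly_Mapping.keys u' \<subseteq> V"
      using assms u by (auto simp: polys_def)
    then have "Poly_Mapping.keys w \<subseteq> V"
      using Poly_Mapping.keys_add[of u u'] u(3) by blast
    moreover have "monomial_degree w \<le> d + e"
      using assms u by (auto simp: polys_def monomial_degree_add intro: add_mono)
    ultimately show ?thesis
      by blast
  qed
  then show ?thesis
    by (simp add: polys_def)
qed

lemma polys_sum: "(\<And>a. a \<in> A \<Longrightarrow> f a \<in> polys V d) \<Longrightarrow> sum f A \<in> polys V d"
  by (induction A rule: infinite_finite_induct) (simp_all add: polys_add)

lemma polys_prod: "finite A \<Longrightarrow> (\<And>a. a \<in> A \<Longrightarrow> f a \<in> polys V 1) \<Longrightarrow> prod f A \<in> polys V (card A)"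
proof (induction A rule: finite_induct)
  case (insert a A)
  then show ?case
    using polys_mult[of "f a" V 1 "prod f A" "card A"] by simp
qed simp

lemma total_degree_polys: "P \<in> polys V d \<Longrightarrow> total_degree P \<le> d"
  by (auto simp: polys_def total_degree_def)

lemma poly_size_polys: "P \<in> polys V d \<Longrightarrow> poly_size P \<le> mons P * d"
  unfolding poly_size_def polys_def
  by (metis (no_types, lifting) mem_Collect_eq of_nat_id sum_bounded_above)

lemma rpoly_decompose:
  "(P :: 'v rpoly) = (\<Sum>u\<in>Poly_Mapping.keys P. Poly_Mapping.single u (Poly_Mapping.lookup P u))"
proof (rule poly_mapping_eqI)
  fix k
  have "Poly_Mapping.lookup (\<Sum>u\<in>Poly_Mapping.keys P. Poly_Mapping.single u (Poly_Mapping.lookup P u)) k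
     = (\<Sum>u\<in>Poly_Mapping.keys P. if u = k then Poly_Mapping.lookup P u else 0)"
    by (simp add: lookup_sum lookup_single when_def)
  also have "\<dots> = Poly_Mapping.lookup P k"
    by (simp add: in_keys_iff)
  finally show "Poly_Mapping.lookup P k = Poly_Mapping.lookup
      (\<Sum>u\<in>Poly_Mapping.keys P. Poly_Mapping.single u (Poly_Mapping.lookup P u)) k" ..
qed

section \<open>Rational constants as a subring\<close>

lemma Const_0 [simp]: "Const 0 = 0"
  by (simp add: Const_def)

lemma Const_1 [simp]: "Const 1 = 1"
  by (simp add: Const_def)

lemma Const_add: "Const (a + b) = Const a + Const b"
  by (simp add: Const_def single_add)

lemma Const_uminus: "Const (- a) = - Const a"
  by (simp add: Const_def single_uminus)

lemma Const_diff: "Const (a - b) = Const a - Const b"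
  by (simp add: Const_def single_diff)

lemma Const_mult: "Const (a * b) = Const a * Const b"
  by (simp add: Const_def mult_single)

lemma Const_sum: "Const (sum f A) = (\<Sum>a\<in>A. Const (f a))"
  by (induction A rule: infinite_finite_induct) (simp_all add: Const_add)

section \<open>Static certificates\<close>

text \<open>
  The number \<open>s\<close> of terms and the degree bound \<open>d\<close> on the multipliers determine the size of the
  corresponding proof, so that its intermediate polynomials need no separate accounting.
\<close>

inductive certificate :: "'v set \<Rightarrow> 'v rpoly set \<Rightarrow> nat \<Rightarrow> nat \<Rightarrow> 'v rpoly \<Rightarrow> bool"
  for V :: "'v set" and G :: "'v rpoly set" and d :: nat where
  zero: "certificate V G d s 0"
| add: "certificate V G d s P \<Longrightarrow> B \<in> G \<Longrightarrow> 0 \<le> a \<Longrightarrow> Poly_Mapping.keys u \<subseteq> V \<Longrightarrow>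
    monomial_degree u \<le> d \<Longrightarrow> certificate V G d (Suc s) (P + Poly_Mapping.single u a * B)"

lemma certificate_mono:
  "certificate V G d s P \<Longrightarrow> G \<subseteq> G' \<Longrightarrow> d \<le> d' \<Longrightarrow> s \<le> s' \<Longrightarrow> certificate V G' d' s' P"
proof (induction arbitrary: s' rule: certificate.induct)
  case (add s P B a u)
  then obtain s'' where "s' = Suc s''" "s \<le> s''"
    by (metis Suc_le_D Suc_le_mono)
  with add show ?case
    by (auto intro!: certificate.add)
qed (rule certificate.zero)

lemma certificate_base:
  assumes "B \<in> G"
  shows "certificate V G d (Suc 0) B"
  using certificate.add[OF certificate.zero[of V G d 0] assms, of 1 0] by simp

lemma certificate_add:
  "certificate V G d s P \<Longrightarrow> certificate V G d s' Q \<Longrightarrow> certificate V G d (s + s') (P + Q)"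
proof (induction rule: certificate.induct)
  case (zero s)
  then show ?case
    using certificate_mono by fastforce
next
  case (add s P B a u)
  then have "certificate V G d (Suc (s + s')) (P + Q + Poly_Mapping.single u a * B)"
    by (intro certificate.add) auto
  then show ?case
    by (simp add: algebra_simps)
qed

lemma certificate_single_mult:
  assumes "certificate V G d s P" "0 \<le> a" "Poly_Mapping.keys u \<subseteq> V" "monomial_degree u \<le> e"
  shows "certificate V G (d + e) s (Poly_Mapping.single u a * P)"
  using assms(1)
proof (induction rule: certificate.induct)
  case (zero s)
  then show ?case
    by (simp add: certificate.zero)
next
  case (add s P B b u')
  have "Poly_Mapping.keys (u + u') \<subseteq> V"
    using Poly_Mapping.keys_add[of u u'] add assms by blast
  moreover have "monomial_degree (u + u') \<le> d + e"
    using add assms by (simp add: monomial_degree_add)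
  ultimately have "certificate V G (d + e) (Suc s)
      (Poly_Mapping.single u a * P + Poly_Mapping.single (u + u') (a * b) * B)"
    using add assms by (intro certificate.add) auto
  then show ?case
    by (simp add: algebra_simps mult_single[symmetric])
qed

lemma certificate_Const_mult:
  "certificate V G d s P \<Longrightarrow> 0 \<le> a \<Longrightarrow> certificate V G d s (Const a * P)"
  using certificate_single_mult[of V G d s P a 0 0] by (simp add: Const_def)

lemma certificate_sum:
  "(\<And>a. a \<in> A \<Longrightarrow> certificate V G d s (f a)) \<Longrightarrow> certificate V G d (card A * s) (sum f A)"
proof (induction A rule: infinite_finite_induct)
  case (insert a A)
  then show ?case
    using certificate_add[of V G d s "f a" "card A * s" "sum f A"] by simp
qed (auto intro: certificate.zero)

text \<open>Inequalities may only be scaled by nonnegative multipliers. With both signs available, a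
  polynomial behaves like an element of an ideal and may be multiplied by anything.\<close>

definition cert_zero :: "'v set \<Rightarrow> 'v rpoly set \<Rightarrow> nat \<Rightarrow> nat \<Rightarrow> 'v rpoly \<Rightarrow> bool" where
  "cert_zero V G d s P \<longleftrightarrow> certificate V G d s P \<and> certificate V G d s (- P)"

lemma cert_zero_mono:
  "cert_zero V G d s P \<Longrightarrow> G \<subseteq> G' \<Longrightarrow> d \<le> d' \<Longrightarrow> s \<le> s' \<Longrightarrow> cert_zero V G' d' s' P"
  unfolding cert_zero_def using certificate_mono by blast

lemma cert_zero_0: "cert_zero V G d s 0"
  by (simp add: cert_zero_def certificate.zero)

lemma cert_zero_base: "B \<in> G \<Longrightarrow> - B \<in> G \<Longrightarrow> cert_zero V G d (Suc 0) B"
  by (simp add: cert_zero_def certificate_base)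

lemma cert_zero_add:
  "cert_zero V G d s P \<Longrightarrow> cert_zero V G d s' Q \<Longrightarrow> cert_zero V G d (s + s') (P + Q)"
  unfolding cert_zero_def
  using certificate_add[of V G d s P s' Q] certificate_add[of V G d s "- P" s' "- Q"] by simp

lemma cert_zero_sum:
  "(\<And>a. a \<in> A \<Longrightarrow> cert_zero V G d s (f a)) \<Longrightarrow> cert_zero V G d (card A * s) (sum f A)"
  unfolding cert_zero_def
  using certificate_sum[of A V G d s f] certificate_sum[of A V G d s "\<lambda>a. - f a"]
  by (simp add: sum_negf)

lemma cert_zero_single_mult:
  assumes "cert_zero V G d s P" "Poly_Mapping.keys u \<subseteq> V" "monomial_degree u \<le> e"
  shows "cert_zero V G (d + e) s (Poly_Mapping.single u a * P)"
proof (cases "0 \<le> a")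
  case True
  then show ?thesis
    using certificate_single_mult[of V G d s _ a u e] assms by (force simp: cert_zero_def)
next
  case False
  have "Poly_Mapping.single u a = - Poly_Mapping.single u (- a)"
    by (simp add: single_uminus)
  then show ?thesis
    using certificate_single_mult[of V G d s _ "- a" u e] assms False
    by (force simp: cert_zero_def)
qed

text \<open>The multiplier is split into its monomials, each of which costs \<open>s\<close> terms.
  Sparse multipliers therefore matter, and monomials are free.\<close>

lemma cert_zero_mult:
  assumes "cert_zero V G d s P" "Q \<in> polys V e"
  shows "cert_zero V G (d + e) (mons Q * s) (Q * P)"
proof -
  have "cert_zero V G (d + e) s (Poly_Mapping.single u (Poly_Mapping.lookup Q u) * P)"
    if "u \<in> Poly_Mapping.keys Q" for u
    using assms that by (auto simp: polys_def intro: cert_zero_single_mult)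
  then have "cert_zero V G (d + e) (mons Q * s)
      (\<Sum>u\<in>Poly_Mapping.keys Q. Poly_Mapping.single u (Poly_Mapping.lookup Q u) * P)"
    by (rule cert_zero_sum)
  then show ?thesis
    by (subst rpoly_decompose[of Q]) (simp add: sum_distrib_right)
qed

lemma cert_zero_Const_mult: "cert_zero V G d s P \<Longrightarrow> cert_zero V G d s (Const a * P)"
  using cert_zero_single_mult[of V G d s P 0 0 a] by (simp add: Const_def)

lemma certificate_add_zero:
  "certificate V G d s P \<Longrightarrow> cert_zero V G d s' Q \<Longrightarrow> certificate V G d (s + s') (P + Q)"
  unfolding cert_zero_def by (auto intro: certificate_add)

section \<open>From certificates to proofs\<close>

lemma sa_proof_snoc:
  assumes "sa_proof V H \<pi>" "P \<in> H \<or> P \<in> sa_axioms V \<or> sa_infers V (set \<pi>) P"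
  shows "sa_proof V H (\<pi> @ [P])"
  using assms by (auto simp: sa_proof_def nth_append less_Suc_eq)

text \<open>Only the appended lines are counted and bounded. The lines of \<open>\<pi>\<close> stay
  available to all later inferences, and this sharing is where the proof ceases to be
  tree-like.\<close>

definition sa_extends ::
    "'v set \<Rightarrow> 'v rpoly set \<Rightarrow> 'v rpoly set \<Rightarrow> 'v rpoly list \<Rightarrow> nat \<Rightarrow> 'v rpoly list \<Rightarrow> bool" where
  "sa_extends V H L \<pi> k \<rho> \<longleftrightarrow> sa_proof V H (\<pi> @ \<rho>) \<and> length \<rho> \<le> k \<and> set \<rho> \<subseteq> L"

lemma sa_extends_Nil: "sa_proof V H \<pi> \<Longrightarrow> sa_extends V H L \<pi> k []"
  by (simp add: sa_extends_def)

lemma sa_extends_trans: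
  "sa_extends V H L \<pi> k \<rho> \<Longrightarrow> sa_extends V H L (\<pi> @ \<rho>) k' \<rho>' \<Longrightarrow>
    sa_extends V H L \<pi> (k + k') (\<rho> @ \<rho>')"
  by (auto simp: sa_extends_def)

lemma sa_extends_snoc:
  assumes "sa_extends V H L \<pi> k \<rho>" "P \<in> L"
    "P \<in> H \<or> P \<in> sa_axioms V \<or> sa_infers V (set (\<pi> @ \<rho>)) P"
  shows "sa_extends V H L \<pi> (Suc k) (\<rho> @ [P])"
  using assms sa_proof_snoc[of V H "\<pi> @ \<rho>" P] by (auto simp: sa_extends_def)

lemma sa_extends_mono:
  "sa_extends V H L \<pi> k \<rho> \<Longrightarrow> k \<le> k' \<Longrightarrow> sa_extends V H L \<pi> k' \<rho>"
  by (simp add: sa_extends_def)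

definition bounded_lines :: "'v set \<Rightarrow> nat \<Rightarrow> nat \<Rightarrow> 'v rpoly set" where
  "bounded_lines V K D = {P \<in> polys V D. mons P \<le> K}"

lemma bounded_lines_mono:
  "K \<le> K' \<Longrightarrow> D \<le> D' \<Longrightarrow> bounded_lines V K D \<subseteq> bounded_lines V K' D'"
  using polys_mono[of D D' V] by (auto simp: bounded_lines_def)

lemma monomial_degree_SucE:
  assumes "monomial_degree u = Suc k"
  obtains v u' where "u = u' + Poly_Mapping.single v 1" "monomial_degree u' = k"
    "v \<in> Poly_Mapping.keys u" "Poly_Mapping.keys u' \<subseteq> Poly_Mapping.keys u"
proof -
  obtain v where v: "v \<in> Poly_Mapping.keys u"
    using assms by (force simp: monomial_degree_def)
  define u' where "u' = u - Poly_Mapping.single v 1"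
  have u: "u = u' + Poly_Mapping.single v 1"
    using v by (intro poly_mapping_eqI)
      (auto simp: u'_def lookup_add lookup_minus lookup_single when_def in_keys_iff)
  moreover have "Poly_Mapping.keys u' \<subseteq> Poly_Mapping.keys u"
    by (auto simp: u'_def in_keys_iff lookup_minus)
  moreover have "monomial_degree u' = k"
    using assms by (subst (asm) u) (simp add: monomial_degree_add)
  ultimately show ?thesis
    using that v by blast
qed

text \<open>One lifting step per variable occurrence in \<open>u\<close>. Multiplication by a
  monomial does not increase the number of monomials, so the intermediate lines stay as sparse as
  \<open>B\<close>.\<close>

lemma sa_extends_monomial_mult:
  assumes "sa_proof V H \<pi>" "B \<in> set \<pi>" "B \<in> bounded_lines V K e"
    "Poly_Mapping.keys u \<subseteq> V" "monomial_degree u = k" "K \<le> K'" "e + k \<le> D"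
  shows "\<exists>\<rho>. sa_extends V H (bounded_lines V K' D) \<pi> k \<rho> \<and>
    Poly_Mapping.single u 1 * B \<in> set (\<pi> @ \<rho>)"
  using assms(4,5,7)
proof (induction k arbitrary: u)
  case 0
  then have "u = 0"
    by (auto simp: monomial_degree_def in_keys_iff intro!: poly_mapping_eqI)
  then show ?case
    using assms by (auto intro!: exI[of _ "[]"] sa_extends_Nil)
next
  case (Suc k)
  obtain v u' where u: "u = u' + Poly_Mapping.single v 1" "monomial_degree u' = k"
    "v \<in> Poly_Mapping.keys u" "Poly_Mapping.keys u' \<subseteq> Poly_Mapping.keys u"
    using Suc.prems(2) by (rule monomial_degree_SucE)
  obtain \<rho> where \<rho>: "sa_extends V H (bounded_lines V K' D) \<pi> k \<rho>"
    "Poly_Mapping.single u' 1 * B \<in> set (\<pi> @ \<rho>)"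
    using Suc.IH[of u'] u Suc.prems by auto
  have eq: "Poly_Mapping.single u 1 * B = Poly_Mapping.single u' 1 * B * Var v"
    by (simp add: Var_def u(1) mult_single mult.assoc mult.commute[of B])
      (simp add: mult.assoc[symmetric] mult_single)
  have "Poly_Mapping.single u 1 * B \<in> polys V (Suc k + e)"
    using Suc.prems assms(3) by (intro polys_mult polys_single) (auto simp: bounded_lines_def)
  then have "Poly_Mapping.single u 1 * B \<in> polys V D"
    using polys_mono[of "Suc k + e" D V] Suc.prems by auto
  moreover have "mons (Poly_Mapping.single u 1 * B) \<le> K'"
    using assms(3,6) mons_single_mult[of u 1 B] by (simp add: bounded_lines_def)
  ultimately have "Poly_Mapping.single u 1 * B \<in> bounded_lines V K' D"
    by (simp add: bounded_lines_def)
  moreover have "sa_infers V (set (\<pi> @ \<rho>)) (Poly_Mapping.single u 1 * B)"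
    unfolding eq using \<rho>(2) u(3) Suc.prems(1) by (intro sa_infers.mult_var) auto
  ultimately have "sa_extends V H (bounded_lines V K' D) \<pi> (Suc k)
      (\<rho> @ [Poly_Mapping.single u 1 * B])"
    using \<rho>(1) by (intro sa_extends_snoc) auto
  then show ?case
    by (intro exI[of _ "\<rho> @ [Poly_Mapping.single u 1 * B]"]) simp
qed

text \<open>The assumption \<open>0 \<in> set \<pi>\<close> provides the line of the empty combination.\<close>

lemma sa_extends_certificate:
  assumes "certificate V (H \<union> sa_axioms V \<union> \<Gamma>) d s P"
    and "sa_proof V H \<pi>" "0 \<in> set \<pi>" "\<Gamma> \<subseteq> set \<pi>"
    and "H \<union> sa_axioms V \<union> \<Gamma> \<subseteq> bounded_lines V K e" "K * s \<le> K'" "e + d \<le> D"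
  shows "\<exists>\<rho>. sa_extends V H (bounded_lines V K' D) \<pi> (s * (d + 2)) \<rho> \<and> P \<in> set (\<pi> @ \<rho>)
    \<and> P \<in> bounded_lines V (K * s) D"
  using assms(1,6)
proof (induction rule: certificate.induct)
  case (zero s)
  then show ?case
    using assms by (auto intro!: exI[of _ "[]"] sa_extends_Nil simp: bounded_lines_def)
next
  case (add s P B a u)
  let ?L = "bounded_lines V K' D"
  obtain \<rho> where \<rho>: "sa_extends V H ?L \<pi> (s * (d + 2)) \<rho>" "P \<in> set (\<pi> @ \<rho>)"
    "P \<in> bounded_lines V (K * s) D"
    using add by auto
  have B: "B \<in> bounded_lines V K e"
    using add assms by blast
  have K: "K \<le> K'"
    using add.prems by simp
  \<comment> \<open>A term costs at most \<open>d + 2\<close> lines: one to write down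
    \<open>B\<close> if it is a hypothesis or an axiom, at most \<open>d\<close> liftings, and one
    linear combination.\<close>
  have "\<exists>\<rho>'. sa_extends V H ?L \<pi> (s * (d + 2) + 1) \<rho>' \<and> P \<in> set (\<pi> @ \<rho>') \<and> B \<in> set (\<pi> @ \<rho>')"
  proof (cases "B \<in> \<Gamma>")
    case True
    then have "B \<in> set (\<pi> @ \<rho>)"
      using assms by auto
    then show ?thesis
      using \<rho> sa_extends_mono[OF \<rho>(1), of "s * (d + 2) + 1"] by fastforce
  next
    case False
    have "B \<in> ?L"
      using B bounded_lines_mono[of K K' e D V] K assms(7) by auto
    then have "sa_extends V H ?L \<pi> (Suc (s * (d + 2))) (\<rho> @ [B])"
      using False add.hyps by (intro sa_extends_snoc[OF \<rho>(1)]) auto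
    then show ?thesis
      using \<rho>(2) by (intro exI[of _ "\<rho> @ [B]"]) auto
  qed
  then obtain \<rho>' where \<rho>': "sa_extends V H ?L \<pi> (s * (d + 2) + 1) \<rho>'"
    "P \<in> set (\<pi> @ \<rho>')" "B \<in> set (\<pi> @ \<rho>')"
    by blast
  then have "sa_proof V H (\<pi> @ \<rho>')"
    by (simp add: sa_extends_def)
  from sa_extends_monomial_mult[OF this \<rho>'(3) B add.hyps(4) refl K, of D]
  obtain \<rho>'' where \<rho>'': "sa_extends V H ?L (\<pi> @ \<rho>') (monomial_degree u) \<rho>''"
    "Poly_Mapping.single u 1 * B \<in> set ((\<pi> @ \<rho>') @ \<rho>'')"
    using add.hyps(5) assms(7) by auto
  let ?R = "P + Poly_Mapping.single u a * B"
  have ext: "sa_extends V H ?L \<pi> (s * (d + 2) + 1 + monomial_degree u) (\<rho>' @ \<rho>'')"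
    by (rule sa_extends_trans[OF \<rho>'(1) \<rho>''(1)])
  have eq: "?R = Const 1 * P + Const a * (Poly_Mapping.single u 1 * B)"
    by (simp add: Const_def mult_single mult.assoc[symmetric])
  have inf: "sa_infers V (set (\<pi> @ \<rho>' @ \<rho>'')) ?R"
    unfolding eq using \<rho>'(2) \<rho>''(2) add.hyps by (intro sa_infers.lin_comb) auto
  have "Poly_Mapping.single u a * B \<in> polys V (d + e)"
    using add.hyps B by (intro polys_mult polys_single) (auto simp: bounded_lines_def)
  then have "?R \<in> polys V D"
    using \<rho>(3) polys_mono[of "d + e" D V] assms(7)
    by (intro polys_add) (auto simp: bounded_lines_def)
  moreover have "mons ?R \<le> K * s + K"
    using \<rho>(3) B mons_single_mult[of u a B] mons_add[of P "Poly_Mapping.single u a * B"]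
    by (simp add: bounded_lines_def)
  ultimately have R: "?R \<in> bounded_lines V (K * Suc s) D"
    by (simp add: bounded_lines_def)
  then have "?R \<in> ?L"
    using bounded_lines_mono[of "K * Suc s" K' D D V] add.prems by auto
  with ext inf have "sa_extends V H ?L \<pi> (Suc (s * (d + 2) + 1 + monomial_degree u))
      ((\<rho>' @ \<rho>'') @ [?R])"
    by (intro sa_extends_snoc) auto
  then have "sa_extends V H ?L \<pi> (Suc s * (d + 2)) ((\<rho>' @ \<rho>'') @ [?R])"
    using add.hyps(5) by (elim sa_extends_mono) simp
  then show ?case
    using R by (intro exI[of _ "(\<rho>' @ \<rho>'') @ [?R]"]) auto
qed

lemma sa_extends_certificate_set:
  assumes "finite \<Delta>" "\<And>P. P \<in> \<Delta> \<Longrightarrow> certificate V (H \<union> sa_axioms V \<union> \<Gamma>) d s P"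
    and "sa_proof V H \<pi>" "0 \<in> set \<pi>" "\<Gamma> \<subseteq> set \<pi>"
    and "H \<union> sa_axioms V \<union> \<Gamma> \<subseteq> bounded_lines V K e" "K * s \<le> K'" "e + d \<le> D"
  shows "\<exists>\<rho>. sa_extends V H (bounded_lines V K' D) \<pi> (card \<Delta> * (s * (d + 2))) \<rho> \<and>
    \<Delta> \<subseteq> set (\<pi> @ \<rho>)"
  using assms(1,2)
proof (induction \<Delta> rule: finite_induct)
  case empty
  then show ?case
    using assms by (auto intro!: exI[of _ "[]"] sa_extends_Nil)
next
  case (insert P \<Delta>)
  then obtain \<rho> where \<rho>: "sa_extends V H (bounded_lines V K' D) \<pi> (card \<Delta> * (s * (d + 2))) \<rho>"
    "\<Delta> \<subseteq> set (\<pi> @ \<rho>)"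
    by auto
  have "\<exists>\<rho>'. sa_extends V H (bounded_lines V K' D) (\<pi> @ \<rho>) (s * (d + 2)) \<rho>' \<and>
      P \<in> set ((\<pi> @ \<rho>) @ \<rho>') \<and> P \<in> bounded_lines V (K * s) D"
    using \<rho> insert.prems assms(4,5)
    by (intro sa_extends_certificate[OF _ _ _ _ assms(6-8)]) (auto simp: sa_extends_def)
  then obtain \<rho>' where \<rho>': "sa_extends V H (bounded_lines V K' D) (\<pi> @ \<rho>) (s * (d + 2)) \<rho>'"
    "P \<in> set ((\<pi> @ \<rho>) @ \<rho>')"
    by blast
  from sa_extends_trans[OF \<rho>(1) \<rho>'(1)]
  have "sa_extends V H (bounded_lines V K' D) \<pi> (card (insert P \<Delta>) * (s * (d + 2))) (\<rho> @ \<rho>')"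
    using insert.hyps by (simp add: add.commute)
  then show ?case
    using \<rho>(2) \<rho>'(2) by (intro exI[of _ "\<rho> @ \<rho>'"]) auto
qed

lemma proof_size_bounded_lines:
  assumes "set \<pi> \<subseteq> bounded_lines V K D"
  shows "proof_size \<pi> \<le> length \<pi> * (K * D)"
proof -
  have "poly_size P \<le> K * D" if "P \<in> set \<pi>" for P
  proof -
    have "P \<in> polys V D" "mons P \<le> K"
      using assms that by (auto simp: bounded_lines_def)
    then show ?thesis
      using poly_size_polys[of P V D] mult_le_mono1[of "mons P" K D] by linarith
  qed
  then show ?thesis
    unfolding proof_size_def by (induction \<pi>) (auto simp: add_mono)
qed

lemma proof_degree_bounded_lines:
  "set \<pi> \<subseteq> bounded_lines V K D \<Longrightarrow> proof_degree \<pi> \<le> D"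
  unfolding proof_degree_def by (auto simp: bounded_lines_def dest!: subsetD total_degree_polys)

section \<open>Integrality of affine forms\<close>

definition unknown :: "nat \<Rightarrow> nat \<Rightarrow> enc_var rpoly" where
  "unknown p i = (\<Sum>l<p. Const (of_nat l) * Var (i, l))"

definition affine :: "nat \<Rightarrow> nat \<Rightarrow> rat \<Rightarrow> (nat \<Rightarrow> rat) \<Rightarrow> enc_var rpoly" where
  "affine p n c t = Const c + (\<Sum>i=1..n. Const (t i) * unknown p i)"

text \<open>
  Nonnegativity of \<open>gap p n (c + k) t\<close> for all integers \<open>k\<close> expresses that the affine form
  \<open>affine p n c t\<close> takes an integer value, by forbidding the open interval between \<open>- k\<close> and \<open>1 - k\<close>.
\<close>

definition gap :: "nat \<Rightarrow> nat \<Rightarrow> rat \<Rightarrow> (nat \<Rightarrow> rat) \<Rightarrow> enc_var rpoly" where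
  "gap p n c t = affine p n c t * (affine p n c t - 1)"

definition indicator_poly :: "nat set \<Rightarrow> (nat \<Rightarrow> nat) \<Rightarrow> enc_var rpoly" where
  "indicator_poly I z = (\<Prod>i\<in>I. Var (i, z i))"

text \<open>For \<open>I = row_supp n a\<close> these are the polynomials of \<open>enc_row\<close>;
  naming \<open>I\<close> and \<open>z\<close> lets a case distinction refer to the hypothesis that
  rules out \<open>z\<close>.\<close>

definition exclusion :: "nat set \<Rightarrow> (nat \<Rightarrow> nat) \<Rightarrow> enc_var rpoly" where
  "exclusion I z = (\<Sum>i\<in>I. 1 - Var (i, z i)) - 1"

section \<open>Sparsity and degree of affine forms and gap polynomials\<close>

lemma prod_Var_single:
  "finite A \<Longrightarrow> (\<Prod>a\<in>A. Var (f a)) = Poly_Mapping.single (\<Sum>a\<in>A. Poly_Mapping.single (f a) 1) 1"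
  by (induction A rule: finite_induct) (simp_all add: Var_def mult_single)

lemma mons_prod_Var: "finite A \<Longrightarrow> mons (\<Prod>a\<in>A. Var (f a)) \<le> 1"
  by (simp add: prod_Var_single)

lemma mons_unknown: "mons (unknown p i) \<le> p"
proof -
  have "mons (Const (of_nat l) * Var (i, l)) \<le> 1" for l
    using mons_single_mult[of 0 "of_nat l" "Var (i, l)"] mons_Var[of "(i, l)"]
    unfolding Const_def by linarith
  then have "mons (\<Sum>l<p. Const (of_nat l) * Var (i, l)) \<le> card {..<p} * 1"
    by (intro mons_sum) auto
  then show ?thesis
    by (simp add: unknown_def)
qed

lemma mons_affine: "mons (affine p n c t) \<le> n * p + 1"
proof -
  have "mons (Const (t i) * unknown p i) \<le> p" for i
    using mons_single_mult[of 0 "t i" "unknown p i"] mons_unknown[of p i]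
    unfolding Const_def by linarith
  then have "mons (\<Sum>i=1..n. Const (t i) * unknown p i) \<le> card {1..n} * p"
    by (intro mons_sum) auto
  then have "mons (\<Sum>i=1..n. Const (t i) * unknown p i) \<le> n * p"
    by simp
  moreover have "mons (Const c :: enc_var rpoly) \<le> 1"
    by (rule mons_Const)
  ultimately show ?thesis
    unfolding affine_def
    using mons_add[of "Const c" "\<Sum>i=1..n. Const (t i) * unknown p i"] by linarith
qed

lemma polys_affine: "affine p n c t \<in> polys (enc_vars p n) 1"
proof -
  have "Const (of_nat l) * Var (i, l) \<in> polys (enc_vars p n) 1" if "i \<in> {1..n}" "l < p" for i l
    using polys_mult[of "Const (of_nat l)" _ 0 "Var (i, l)" 1] that by (simp add: polys_Var enc_vars_def)
  then have "unknown p i \<in> polys (enc_vars p n) 1" if "i \<in> {1..n}" for i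
    using that unfolding unknown_def by (intro polys_sum) auto
  then have "Const (t i) * unknown p i \<in> polys (enc_vars p n) 1" if "i \<in> {1..n}" for i
    using polys_mult[of "Const (t i)" _ 0 "unknown p i" 1] that by simp
  then show ?thesis
    unfolding affine_def by (intro polys_add polys_sum) auto
qed

lemma affine_add:
  "affine p n (c + c') (\<lambda>i. t i + t' i) = affine p n c t + affine p n c' t'"
  by (simp add: affine_def Const_add sum.distrib algebra_simps)

lemma affine_Const_add: "affine p n (c + c') t = affine p n c t + Const c'"
  by (simp add: affine_def Const_add)

lemma affine_zero: "affine p n c (\<lambda>_. 0) = Const c"
  by (simp add: affine_def)

lemma gap_alt: "gap p n c t = affine p n c t * affine p n (c - 1) t"
  using affine_Const_add[of p n c "-1" t] by (simp add: gap_def Const_uminus)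

lemma mons_gap: "mons (gap p n c t) \<le> (n * p + 1)\<^sup>2"
  unfolding gap_alt power2_eq_square
  by (intro order.trans[OF mons_mult] mult_mono mons_affine) auto

lemma polys_gap: "gap p n c t \<in> polys (enc_vars p n) 2"
  using polys_mult[OF polys_affine polys_affine] unfolding gap_alt by (simp add: numeral_2_eq_2)

text \<open>\<open>G\<close> stays abstract because certificates are needed both from the hypotheses
  and axioms alone and relative to gap inequalities that have already been derived.\<close>

locale zp_encoding =
  fixes p n :: nat and G :: "enc_var rpoly set"
  assumes p_ge_2: "2 \<le> p" and n_ge_1: "1 \<le> n"
    and axioms_G: "sa_axioms (enc_vars p n) \<subseteq> G" and enc_Z_G: "enc_Z p n \<subseteq> G"
begin

abbreviation V :: "enc_var set" where
  "V \<equiv> enc_vars p n"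

abbreviation row_sum :: "nat \<Rightarrow> enc_var rpoly" where
  "row_sum i \<equiv> (\<Sum>l<p. Var (i, l))"

lemma in_V: "i \<in> {1..n} \<Longrightarrow> l < p \<Longrightarrow> (i, l) \<in> V"
  by (simp add: enc_vars_def)

section \<open>Equations for a single unknown\<close>

lemma cert_zero_row_sum:
  assumes "i \<in> {1..n}"
  shows "cert_zero V G 0 1 (1 - row_sum i)"
proof -
  have "1 - row_sum i \<in> G" "row_sum i - 1 \<in> G"
    using assms enc_Z_G unfolding enc_Z_def by blast+
  then show ?thesis
    using cert_zero_base[of "1 - row_sum i"] by simp
qed

lemma cert_zero_idempotent:
  assumes "v \<in> V"
  shows "cert_zero V G 0 1 (Var v * Var v - Var v)"
proof -
  have "Var v * Var v - Var v \<in> G" "Var v - Var v * Var v \<in> G"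
    using assms axioms_G by (auto simp: sa_axioms_def power2_eq_square)
  then show ?thesis
    using cert_zero_base[of "Var v * Var v - Var v"] by simp
qed

lemma certificate_Var: "v \<in> V \<Longrightarrow> certificate V G 0 1 (Var v)"
  using axioms_G certificate_base[of "Var v" G V 0] by (auto simp: sa_axioms_def)

text \<open>The inequality 1 >= 0 is not an axiom, but it is the sum of v >= 0 and 1 - v >= 0 for
  any variable v.\<close>

lemma certificate_one: "certificate V G 0 2 1"
proof -
  have v: "(1, 0) \<in> V"
    using n_ge_1 p_ge_2 by (simp add: in_V)
  then have "certificate V G 0 1 (1 - Var (1, 0))"
    using axioms_G certificate_base[of "1 - Var (1, 0)" G V 0] by (force simp: sa_axioms_def)
  from certificate_add[OF certificate_Var[OF v] this] show ?thesis
    by (simp add: numeral_2_eq_2)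
qed

lemma certificate_Var_mult:
  assumes "v \<in> V" "v' \<in> V"
  shows "certificate V G 1 1 (Var v * Var v')"
  using certificate_single_mult[OF certificate_Var[OF assms(2)], of 1 "Poly_Mapping.single v 1" 1] assms
  by (simp add: Var_def)

text \<open>Multiplying the row equation by \<open>Var (i, l)\<close> and using idempotence shows
  that the products of \<open>Var (i, l)\<close> with the other variables of the row sum to 0. All
  of them are nonnegative, so adding back the remaining \<open>p - 2\<close> bounds a single one
  from above.\<close>

lemma cert_zero_Var_mult:
  assumes "i \<in> {1..n}" "l < p" "l' < p" "l \<noteq> l'"
  shows "cert_zero V G 1 p (Var (i, l) * Var (i, l'))"
proof -
  let ?A = "{..<p} - {l} - {l'}"
  have card: "card ?A = p - 2"
    using assms by simp
  have l: "(i, l) \<in> V"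
    using assms by (simp add: in_V)
  have "row_sum i = Var (i, l) + (Var (i, l') + (\<Sum>l''\<in>?A. Var (i, l'')))"
    using assms by (subst sum.remove[of _ l]; simp; subst sum.remove[of _ l']; simp)
  then have eq: "- (Var (i, l) * Var (i, l')) = Var (i, l) * (1 - row_sum i) +
      (Var (i, l) * Var (i, l) - Var (i, l)) + (\<Sum>l''\<in>?A. Var (i, l) * Var (i, l''))"
    by (simp add: algebra_simps sum_distrib_left)
  have "cert_zero V G 1 1 (Var (i, l) * (1 - row_sum i))"
    using cert_zero_single_mult[OF cert_zero_row_sum[OF assms(1)], of "Poly_Mapping.single (i, l) 1" 1 1] l
    by (simp add: Var_def)
  moreover have "cert_zero V G 1 1 (Var (i, l) * Var (i, l) - Var (i, l))"
    using cert_zero_mono[OF cert_zero_idempotent[OF l]] by auto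
  moreover have "certificate V G 1 (card ?A * 1) (\<Sum>l''\<in>?A. Var (i, l) * Var (i, l''))"
    using assms l by (intro certificate_sum certificate_Var_mult) (auto simp: in_V)
  ultimately have "certificate V G 1 (1 + 1 + card ?A * 1) (- (Var (i, l) * Var (i, l')))"
    unfolding eq cert_zero_def by (intro certificate_add) auto
  moreover have "1 + 1 + card ?A * 1 = p"
    using p_ge_2 card by simp
  moreover have "certificate V G 1 p (Var (i, l) * Var (i, l'))"
    using certificate_mono[OF certificate_Var_mult[OF l, of "(i, l')"]] assms p_ge_2 by (auto simp: in_V)
  ultimately show ?thesis
    unfolding cert_zero_def by auto
qed

text \<open>In the product of \<open>Var (i, z)\<close> with the unknown, the square reduces by
  idempotence and all mixed products vanish, which leaves the value \<open>z\<close>.\<close>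

lemma cert_zero_Var_unknown:
  assumes "i \<in> {1..n}" "z < p"
  shows "cert_zero V G 1 (p * p) (Var (i, z) * (unknown p i - Const (of_nat z)))"
proof -
  let ?A = "{..<p} - {z}"
  have "unknown p i = Const (of_nat z) * Var (i, z) + (\<Sum>l\<in>?A. Const (of_nat l) * Var (i, l))"
    using assms unfolding unknown_def by (subst sum.remove[of _ z]) auto
  then have eq: "Var (i, z) * (unknown p i - Const (of_nat z)) =
      Const (of_nat z) * (Var (i, z) * Var (i, z) - Var (i, z)) +
      (\<Sum>l\<in>?A. Const (of_nat l) * (Var (i, z) * Var (i, l)))"
    by (simp add: algebra_simps sum_distrib_left)
  have "cert_zero V G 1 1 (Const (of_nat z) * (Var (i, z) * Var (i, z) - Var (i, z)))"
    using cert_zero_Const_mult[OF cert_zero_mono[OF cert_zero_idempotent]] assms by (simp add: in_V)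
  moreover have "cert_zero V G 1 (card ?A * p) (\<Sum>l\<in>?A. Const (of_nat l) * (Var (i, z) * Var (i, l)))"
    using assms by (intro cert_zero_sum cert_zero_Const_mult cert_zero_Var_mult) auto
  ultimately have "cert_zero V G 1 (1 + card ?A * p) (Var (i, z) * (unknown p i - Const (of_nat z)))"
    unfolding eq by (intro cert_zero_add)
  moreover have "1 + card ?A * p \<le> p * p"
    using assms by (cases p) auto
  ultimately show ?thesis
    by (elim cert_zero_mono) auto
qed

section \<open>Equations under the indicator of a partial assignment\<close>

lemma polys_prod_Var:
  assumes "finite I" "I \<subseteq> {1..n}" "\<And>i. i \<in> I \<Longrightarrow> z i < p"
  shows "(\<Prod>i\<in>I. Var (i, z i)) \<in> polys V (card I)"
  using assms by (intro polys_prod polys_Var) (auto intro!: in_V)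

text \<open>An equation that holds under one factor of the indicator is lifted by the other
  \<open>card I - 1\<close> factors. They form a single monomial, so the number of terms does not
  grow.\<close>

lemma cert_zero_prod_Var_mult:
  assumes "finite I" "I \<subseteq> {1..n}" "\<And>i. i \<in> I \<Longrightarrow> z i < p" "j \<in> I" "cert_zero V G 1 s (Var (j, z j) * P)"
  shows "cert_zero V G (card I) s (indicator_poly I z * P)"
proof -
  have eq: "indicator_poly I z * P = (\<Prod>i\<in>I - {j}. Var (i, z i)) * (Var (j, z j) * P)"
    using assms unfolding indicator_poly_def by (subst prod.remove[of _ j]) (auto simp: mult_ac)
  have "(\<Prod>i\<in>I - {j}. Var (i, z i)) \<in> polys V (card (I - {j}))"
    using assms by (intro polys_prod_Var) auto
  from cert_zero_mult[OF assms(5) this]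
  show ?thesis
    unfolding eq using assms mons_prod_Var[of "I - {j}" "\<lambda>i. (i, z i)"] card_gt_0_iff[of I]
    by (elim cert_zero_mono) (auto simp: mult_le_mono1)
qed

lemma cert_zero_indicator_affine:
  assumes I: "I \<subseteq> {1..n}" and z: "\<And>i. i \<in> I \<Longrightarrow> z i < p" and t: "\<And>i. i \<notin> I \<Longrightarrow> t i = 0"
  shows "cert_zero V G (card I) (card I * (p * p))
    (indicator_poly I z * (affine p n c t - Const (c + (\<Sum>i\<in>I. t i * of_nat (z i)))))"
proof -
  have fin: "finite I"
    using I by (rule finite_subset) simp
  have "(\<Sum>i=1..n. Const (t i) * unknown p i) = (\<Sum>i\<in>I. Const (t i) * unknown p i)"
    using I t by (intro sum.mono_neutral_right) auto
  then have eq: "indicator_poly I z * (affine p n c t - Const (c + (\<Sum>i\<in>I. t i * of_nat (z i)))) =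
      (\<Sum>i\<in>I. Const (t i) * (indicator_poly I z * (unknown p i - Const (of_nat (z i)))))"
    by (simp add: affine_def Const_add Const_sum Const_mult sum_distrib_left sum_subtractf algebra_simps)
  show ?thesis
    unfolding eq
  proof (intro cert_zero_sum cert_zero_Const_mult)
    fix i assume "i \<in> I"
    then show "cert_zero V G (card I) (p * p) (indicator_poly I z * (unknown p i - Const (of_nat (z i))))"
      using I z fin
      by (intro cert_zero_prod_Var_mult[where j = i and z = z] cert_zero_Var_unknown) auto
  qed
qed

text \<open>Expanding the product of the row sums over \<open>I\<close> yields the sum of all
  indicators. The product is reduced to 1 one row at a time; each replacement multiplies a row
  equation by the product so far, whose monomial count is therefore carried through the
  induction.\<close>

lemma cert_zero_indicator_partition:
  assumes "I \<subseteq> {1..n}"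
  shows "cert_zero V G (card I) (card I * p ^ card I)
    (1 - (\<Sum>z\<in>I \<rightarrow>\<^sub>E {..<p}. indicator_poly I z))"
proof -
  have fin: "finite I"
    using assms by (rule finite_subset) simp
  have "cert_zero V G (card I) (card I * p ^ card I) (1 - (\<Prod>i\<in>I. row_sum i)) \<and>
      mons (\<Prod>i\<in>I. row_sum i) \<le> p ^ card I"
    using fin assms
  proof (induction I rule: finite_induct)
    case (insert j I)
    let ?P = "\<Prod>i\<in>I. row_sum i"
    have eq: "1 - (\<Prod>i\<in>insert j I. row_sum i) = ?P * (1 - row_sum j) + (1 - ?P)"
      using insert.hyps by (simp add: algebra_simps)
    have mons_P: "mons ?P \<le> p ^ card I"
      using insert by auto
    have "?P \<in> polys V (card I)"
      using insert by (intro polys_prod polys_sum polys_Var) (auto intro!: in_V)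
    with insert.prems have "cert_zero V G (0 + card I) (mons ?P * 1) (?P * (1 - row_sum j))"
      by (intro cert_zero_mult cert_zero_row_sum) auto
    then have "cert_zero V G (0 + card I) (mons ?P * 1 + card I * p ^ card I)
        (1 - (\<Prod>i\<in>insert j I. row_sum i))"
      unfolding eq using insert by (intro cert_zero_add) auto
    moreover have "mons ?P * 1 + card I * p ^ card I \<le> card (insert j I) * p ^ card (insert j I)"
    proof -
      have "mons ?P * 1 + card I * p ^ card I \<le> card (insert j I) * p ^ card I"
        using insert.hyps mons_P by simp
      also have "\<dots> \<le> card (insert j I) * p ^ card (insert j I)"
        using insert.hyps p_ge_2 by (intro mult_le_mono power_increasing) auto
      finally show ?thesis .
    qed
    ultimately have "cert_zero V G (card (insert j I)) (card (insert j I) * p ^ card (insert j I))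
        (1 - (\<Prod>i\<in>insert j I. row_sum i))"
      using insert.hyps by (elim cert_zero_mono) auto
    moreover have "mons (row_sum j) \<le> p"
      using mons_sum[of "{..<p}" "\<lambda>l. Var (j, l)" 1, OF mons_Var] by simp
    then have "mons (row_sum j * ?P) \<le> p * p ^ card I"
      using mons_P by (intro order.trans[OF mons_mult] mult_mono) auto
    ultimately show ?case
      using insert.hyps by simp
  qed (simp add: cert_zero_0)
  moreover have "(\<Sum>z\<in>I \<rightarrow>\<^sub>E {..<p}. indicator_poly I z) = (\<Prod>i\<in>I. row_sum i)"
    unfolding indicator_poly_def using fin by (subst prod_sum_PiE) auto
  ultimately show ?thesis
    by simp
qed

lemma certificate_indicator_mult:
  assumes "certificate V G d s P" "finite I" "I \<subseteq> {1..n}" "\<And>i. i \<in> I \<Longrightarrow> z i < p"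
  shows "certificate V G (d + card I) s (indicator_poly I z * P)"
proof -
  let ?u = "\<Sum>i\<in>I. Poly_Mapping.single (i, z i) (1::nat)"
  have "indicator_poly I z = Poly_Mapping.single ?u 1"
    unfolding indicator_poly_def using assms(2) by (rule prod_Var_single)
  moreover have "Poly_Mapping.keys ?u \<subseteq> V"
  proof (rule order.trans[OF keys_sum])
    show "(\<Union>i\<in>I. Poly_Mapping.keys (Poly_Mapping.single (i, z i) (1::nat))) \<subseteq> V"
      using assms by (auto intro!: in_V)
  qed
  moreover have "monomial_degree ?u = card I"
    by (simp add: monomial_degree_sum)
  ultimately show ?thesis
    using certificate_single_mult[OF assms(1), of 1 ?u "card I"] by simp
qed

text \<open>Under the indicator every \<open>1 - Var (i, z i)\<close> with \<open>i\<close> in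
  \<open>I\<close> is 0 by idempotence, so the excluding inequality turns into the negated
  indicator. Nonnegativity of the indicator comes from lifting 1 >= 0.\<close>

lemma cert_zero_excluded:
  assumes I: "I \<subseteq> {1..n}" and z: "\<And>i. i \<in> I \<Longrightarrow> z i < p" and "exclusion I z \<in> G"
  shows "cert_zero V G (card I) (card I + 2) (indicator_poly I z)"
proof -
  have fin: "finite I"
    using I by (rule finite_subset) simp
  have "certificate V G (card I) 2 (indicator_poly I z)"
    using certificate_indicator_mult[OF certificate_one fin I, of z] z by simp
  then have "certificate V G (card I) (card I + 2) (indicator_poly I z)"
    by (rule certificate_mono) auto
  moreover have "certificate V G (card I) (1 + card I * 1) (- indicator_poly I z)"
  proof -
    have eq: "- indicator_poly I z = indicator_poly I z * exclusion I z +
        (\<Sum>i\<in>I. indicator_poly I z * (Var (i, z i) - 1))"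
      by (simp add: exclusion_def sum_distrib_left sum_subtractf algebra_simps)
    have "certificate V G (card I) 1 (indicator_poly I z * exclusion I z)"
      using certificate_indicator_mult[OF certificate_base[OF assms(3), of V 0] fin I, of z] z by simp
    moreover have "cert_zero V G (card I) (card I * 1) (\<Sum>i\<in>I. indicator_poly I z * (Var (i, z i) - 1))"
    proof (intro cert_zero_sum)
      fix i assume i: "i \<in> I"
      then have "cert_zero V G 1 1 (Var (i, z i) * Var (i, z i) - Var (i, z i))"
        using I z cert_zero_mono[OF cert_zero_idempotent[of "(i, z i)"]] in_V[of i "z i"] by auto
      then show "cert_zero V G (card I) 1 (indicator_poly I z * (Var (i, z i) - 1))"
        using i I z fin by (intro cert_zero_prod_Var_mult[of I z i]) (auto simp: algebra_simps)
    qed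
    ultimately show ?thesis
      unfolding eq by (rule certificate_add_zero)
  qed
  then have "certificate V G (card I) (card I + 2) (- indicator_poly I z)"
    by (rule certificate_mono) auto
  ultimately show ?thesis
    by (simp add: cert_zero_def)
qed

text \<open>
  If the form \<open>M\<close> is integral and \<open>T\<close> depends on the unknowns in \<open>I\<close> only, then \<open>M + T\<close> is
  integral: under the indicator of an assignment \<open>z\<close> to \<open>I\<close>, the form \<open>T\<close> is congruent to its
  value at \<open>z\<close>, so the gap inequality of \<open>M + T\<close> becomes a shifted gap inequality of \<open>M\<close>.
\<close>

lemma certificate_gap_step:
  assumes I: "I \<subseteq> {1..n}" "card I \<le> w" and t': "\<And>i. i \<notin> I \<Longrightarrow> t' i = 0"
    and cases: "\<And>z. z \<in> I \<rightarrow>\<^sub>E {..<p} \<Longrightarrow>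
      exclusion I z \<in> G \<or> gap p n (c + (c' + (\<Sum>i\<in>I. t' i * of_nat (z i)))) t \<in> G"
  shows "certificate V G (w + 2) ((n * p + 1)\<^sup>2 * p ^ w * (w + 2) * (p\<^sup>2 + 1))
    (gap p n (c + c') (\<lambda>i. t i + t' i))"
proof -
  let ?g = "gap p n (c + c') (\<lambda>i. t i + t' i)"
  let ?Z = "I \<rightarrow>\<^sub>E {..<p}"
  let ?K = "n * p + 1"
  \<comment> \<open>A bound for one assignment that covers both cases. In the factor
    \<open>p^2 + 1\<close> of the total, \<open>p^2\<close> pays for the at most
    \<open>p ^ w\<close> assignments and 1 for replacing the sum of the indicators by 1.\<close>
  define s where "s = ?K\<^sup>2 * ((w + 2) * p\<^sup>2)"
  have fin: "finite I"
    using I(1) by (rule finite_subset) simp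
  have pp: "1 \<le> p * p"
    using p_ge_2 by simp
  have each: "certificate V G (w + 2) s (indicator_poly I z * ?g)" if z: "z \<in> ?Z" for z
  proof -
    have zp: "z i < p" if "i \<in> I" for i
      using z that by auto
    consider "exclusion I z \<in> G" | "gap p n (c + (c' + (\<Sum>i\<in>I. t' i * of_nat (z i)))) t \<in> G"
      using cases[OF z] by blast
    then show ?thesis
    proof cases
      case 1
      have "cert_zero V G (card I + 2) (mons ?g * (card I + 2)) (?g * indicator_poly I z)"
        by (intro cert_zero_mult cert_zero_excluded polys_gap I zp 1)
      moreover have "mons ?g * (card I + 2) \<le> ?K\<^sup>2 * ((w + 2) * (p * p))"
        using mult_le_mono[OF mons_gap[of p n "c + c'" "\<lambda>i. t i + t' i"] mult_le_mono[of "card I + 2" "w + 2" 1 "p * p"]]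
          I(2) pp by simp
      ultimately have "cert_zero V G (w + 2) s (?g * indicator_poly I z)"
        using I(2) by (elim cert_zero_mono) (auto simp: s_def power2_eq_square)
      then show ?thesis
        by (simp add: cert_zero_def mult.commute)
    next
      case 2
      define \<tau> where "\<tau> = c' + (\<Sum>i\<in>I. t' i * of_nat (z i))"
      let ?a = "affine p n (c + c') (\<lambda>i. t i + t' i)" and ?b = "affine p n (c + \<tau>) t"
      \<comment> \<open>The cofactor in a(a - 1) - b(b - 1) = (a + b - 1)(a - b). Writing a + b - 1
        as one affine form makes the bounds for affine forms apply to it directly.\<close>
      let ?m = "affine p n (c + c' + (c + \<tau> - 1)) (\<lambda>i. (t i + t' i) + t i)"
      let ?e = "indicator_poly I z * (affine p n c' t' - Const \<tau>)"
      have m: "?m = ?a + ?b - 1"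
        using affine_Const_add[of p n "c + \<tau>" "-1" t] unfolding affine_add
        by (simp add: Const_uminus affine_add)
      have ab: "?a - ?b = affine p n c' t' - Const \<tau>"
        by (simp add: affine_add affine_Const_add)
      have "?g - gap p n (c + \<tau>) t = (?a + ?b - 1) * (?a - ?b)"
        by (simp add: gap_def algebra_simps)
      then have "indicator_poly I z * (?g - gap p n (c + \<tau>) t) = ?m * ?e"
        unfolding m ab by (simp add: mult_ac)
      then have eq: "indicator_poly I z * ?g = indicator_poly I z * gap p n (c + \<tau>) t + ?m * ?e"
        by (simp add: algebra_simps)
      have "certificate V G (card I + 1) 1 (indicator_poly I z * gap p n (c + \<tau>) t)"
        using certificate_indicator_mult[OF certificate_base[OF 2, of V 0] fin I(1), of z] zp
        by (auto simp: \<tau>_def elim: certificate_mono)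
      moreover have "cert_zero V G (card I + 1) (mons ?m * (card I * (p * p))) (?m * ?e)"
        unfolding \<tau>_def by (intro cert_zero_mult polys_affine cert_zero_indicator_affine I zp t')
      ultimately have "certificate V G (card I + 1) (1 + mons ?m * (card I * (p * p)))
          (indicator_poly I z * ?g)"
        unfolding eq by (rule certificate_add_zero)
      moreover have "1 + mons ?m * (card I * (p * p)) \<le> s"
      proof -
        have "1 + mons ?m * (card I * (p * p)) \<le> 1 + ?K * (w * (p * p))"
          using mons_affine I(2) by (intro add_mono mult_mono) auto
        also have "1 * 1 \<le> ?K * (p * p)"
          by (intro mult_le_mono pp) simp
        then have "1 + ?K * (w * (p * p)) \<le> ?K * (p * p) + ?K * (w * (p * p))"
          by (simp only: mult_1 add_le_cancel_right)
        also have "\<dots> = ?K * ((w + 1) * (p * p))"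
          by (simp add: algebra_simps)
        also have "\<dots> \<le> ?K\<^sup>2 * ((w + 2) * (p * p))"
          by (intro mult_mono) (auto simp: power2_eq_square)
        finally show ?thesis
          by (simp add: s_def power2_eq_square)
      qed
      ultimately show ?thesis
        using I(2) by (elim certificate_mono) auto
    qed
  qed
  have card_Z: "card ?Z = p ^ card I"
    using fin by (simp add: card_PiE)
  \<comment> \<open>The indicators form a partition of unity, so the polynomial is the sum of its
    restrictions plus a multiple of an equation.\<close>
  have eq: "?g = (\<Sum>z\<in>?Z. indicator_poly I z * ?g) + ?g * (1 - (\<Sum>z\<in>?Z. indicator_poly I z))"
    by (simp add: right_diff_distrib sum_distrib_right mult.commute[of ?g])
  have "certificate V G (w + 2) (p ^ card I * s) (\<Sum>z\<in>?Z. indicator_poly I z * ?g)"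
    using certificate_sum[of ?Z V G "w + 2" s] each by (simp add: card_Z)
  moreover have "cert_zero V G (card I + 2) (mons ?g * (card I * p ^ card I))
      (?g * (1 - (\<Sum>z\<in>?Z. indicator_poly I z)))"
    by (intro cert_zero_mult cert_zero_indicator_partition polys_gap I)
  then have "cert_zero V G (w + 2) (mons ?g * (card I * p ^ card I))
      (?g * (1 - (\<Sum>z\<in>?Z. indicator_poly I z)))"
    using I(2) by (elim cert_zero_mono) auto
  ultimately have "certificate V G (w + 2) (p ^ card I * s + mons ?g * (card I * p ^ card I)) ?g"
    by (subst eq) (rule certificate_add_zero)
  moreover have "p ^ card I * s + mons ?g * (card I * p ^ card I) \<le> ?K\<^sup>2 * p ^ w * (w + 2) * (p\<^sup>2 + 1)"
  proof -
    have p_pow: "p ^ card I \<le> p ^ w"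
      using I(2) p_ge_2 by (intro power_increasing) auto
    have "p ^ card I * s + mons ?g * (card I * p ^ card I) \<le> p ^ w * s + ?K\<^sup>2 * ((w + 2) * p ^ w)"
      using mons_gap[of p n "c + c'" "\<lambda>i. t i + t' i"] p_pow I(2) by (intro add_mono mult_mono) auto
    also have "\<dots> = ?K\<^sup>2 * p ^ w * (w + 2) * (p\<^sup>2 + 1)"
      by (simp add: s_def algebra_simps)
    finally show ?thesis .
  qed
  ultimately show ?thesis
    by (elim certificate_mono) auto
qed

end

section \<open>Chains of integral forms\<close>

text \<open>A proof can contain only finitely many shifts, and every step derives a whole window of
  them, because the next step uses a different shift in each case.\<close>

definition gaps :: "nat \<Rightarrow> nat \<Rightarrow> rat \<Rightarrow> (nat \<Rightarrow> rat) \<Rightarrow> nat \<Rightarrow> enc_var rpoly set" where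
  "gaps p n c t R = (\<lambda>k. gap p n (c + of_int k) t) ` {- int R..int R}"

lemma finite_gaps: "finite (gaps p n c t R)"
  by (simp add: gaps_def)

lemma card_gaps: "card (gaps p n c t R) \<le> 2 * R + 1"
  unfolding gaps_def by (rule order.trans[OF card_image_le]) auto

type_synonym step = "nat set \<times> rat \<times> (nat \<Rightarrow> rat)"

text \<open>A step is a form with constant \<open>c\<close> and coefficients \<open>t\<close>
  supported in \<open>I\<close>. The bound \<open>r\<close> on its values is the amount by which the
  window of shifts shrinks.\<close>

fun valid_step :: "nat \<Rightarrow> nat \<Rightarrow> enc_var rpoly set \<Rightarrow> nat \<Rightarrow> nat \<Rightarrow> step \<Rightarrow> bool" where
  "valid_step p n H w r (I, c, t) \<longleftrightarrow> I \<subseteq> {1..n} \<and> card I \<le> w \<and> (\<forall>i. i \<notin> I \<longrightarrow> t i = 0) \<and>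
    (\<forall>z\<in>I \<rightarrow>\<^sub>E {..<p}. exclusion I z \<in> H \<or>
      (\<exists>k::int. c + (\<Sum>i\<in>I. t i * of_nat (z i)) = of_int k \<and> \<bar>k\<bar> \<le> int r))"

definition step_size :: "nat \<Rightarrow> nat \<Rightarrow> nat \<Rightarrow> nat" where
  "step_size p n w = (n * p + 1)\<^sup>2 * p ^ w * (w + 2) * (p\<^sup>2 + 1)"

lemma sa_axioms_bounded: "sa_axioms V \<subseteq> bounded_lines V 2 2"
proof -
  have "{Var v, 1 - Var v, (Var v)\<^sup>2 - Var v, Var v - (Var v)\<^sup>2} \<subseteq> bounded_lines V 2 2"
    if v: "v \<in> V" for v
  proof -
    have m1: "mons (Var v) = 1"
      by (simp add: Var_def)
    have m2: "mons ((Var v)\<^sup>2) \<le> 1"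
      using mons_mult[of "Var v" "Var v"] by (simp add: m1 power2_eq_square)
    have p1: "Var v \<in> polys V 2"
      using v by (intro polys_Var) auto
    have p2: "(Var v)\<^sup>2 \<in> polys V 2"
      using polys_mult[of "Var v" V 1 "Var v" 1] v by (simp add: polys_Var power2_eq_square numeral_2_eq_2)
    show ?thesis
      using m1 m2 p1 p2 mons_diff[of 1 "Var v"] mons_diff[of "(Var v)\<^sup>2" "Var v"]
        mons_diff[of "Var v" "(Var v)\<^sup>2"]
      by (auto simp: bounded_lines_def intro!: polys_diff)
  qed
  then show ?thesis
    unfolding sa_axioms_def by blast
qed

locale bounded_hypotheses =
  fixes p n w K :: nat and H :: "enc_var rpoly set"
  assumes p_ge_2: "2 \<le> p" and n_ge_1: "1 \<le> n" and enc_Z_H: "enc_Z p n \<subseteq> H"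
    and H_bounded: "H \<subseteq> bounded_lines (enc_vars p n) K 2" and K_ge: "(n * p + 1)\<^sup>2 \<le> K"
begin

abbreviation V :: "enc_var set" where
  "V \<equiv> enc_vars p n"

abbreviation S :: nat where
  "S \<equiv> step_size p n w"

text \<open>Certificates have at most \<open>S\<close> terms over polynomials with at most
  \<open>K\<close> monomials and degree at most 2; multipliers of degree \<open>w + 2\<close> give
  total degree \<open>w + 4\<close>.\<close>

abbreviation L :: "enc_var rpoly set" where
  "L \<equiv> bounded_lines V (K * S) (w + 4)"

lemma K_ge_2: "2 \<le> K"
proof -
  have "2 * 1 \<le> (n * p + 1) * (n * p + 1)"
    using p_ge_2 n_ge_1 by (intro mult_le_mono) auto
  then show ?thesis
    using K_ge by (simp add: power2_eq_square)
qed

lemma S_ge_2: "2 \<le> S"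
proof -
  have "1 * 1 * 2 * 1 \<le> S"
    unfolding step_size_def using p_ge_2 by (intro mult_le_mono) auto
  then show ?thesis
    by simp
qed

lemma base_bounded: "H \<union> sa_axioms V \<union> gaps p n c t R \<subseteq> bounded_lines V K 2"
proof -
  have "gaps p n c t R \<subseteq> bounded_lines V K 2"
    using order.trans[OF mons_gap K_ge] polys_gap by (auto simp: gaps_def bounded_lines_def)
  moreover have "sa_axioms V \<subseteq> bounded_lines V K 2"
    using sa_axioms_bounded bounded_lines_mono[of 2 K 2 2 V] K_ge_2 by auto
  ultimately show ?thesis
    using H_bounded by simp
qed

text \<open>Under an assignment with form value \<open>k'\<close>, the shift \<open>k\<close> of the
  new sum becomes the shift \<open>k + k'\<close> of the old one, which stays inside the window
  widened by \<open>r\<close>.\<close>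

lemma certificate_valid_step:
  assumes "valid_step p n H w r (I, c', t')" "P \<in> gaps p n (c + c') (\<lambda>i. t i + t' i) R"
  shows "certificate V (H \<union> sa_axioms V \<union> gaps p n c t (R + r)) (w + 2) S P"
proof -
  let ?G = "H \<union> sa_axioms V \<union> gaps p n c t (R + r)"
  interpret base: zp_encoding p n ?G
    using p_ge_2 n_ge_1 enc_Z_H by unfold_locales auto
  obtain k where k: "P = gap p n (c + c' + of_int k) (\<lambda>i. t i + t' i)" "\<bar>k\<bar> \<le> int R"
    using assms(2) by (auto simp: gaps_def)
  have "certificate V ?G (w + 2) S (gap p n (c + of_int k + c') (\<lambda>i. t i + t' i))"
    unfolding step_size_def
  proof (rule base.certificate_gap_step)
    show "I \<subseteq> {1..n}" "card I \<le> w" "\<And>i. i \<notin> I \<Longrightarrow> t' i = 0"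
      using assms(1) by auto
    fix z assume z: "z \<in> I \<rightarrow>\<^sub>E {..<p}"
    let ?v = "c' + (\<Sum>i\<in>I. t' i * of_nat (z i))"
    consider "exclusion I z \<in> H" | k' where "?v = of_int k'" "\<bar>k'\<bar> \<le> int r"
      using assms(1) z by fastforce
    then show "exclusion I z \<in> ?G \<or> gap p n (c + of_int k + ?v) t \<in> ?G"
    proof cases
      case 2
      have "gap p n (c + of_int k + ?v) t = gap p n (c + of_int (k + k')) t"
        using 2 by (simp add: add.assoc)
      also have "\<dots> \<in> gaps p n c t (R + r)"
        using 2 k unfolding gaps_def by (intro imageI) auto
      finally show ?thesis
        by blast
    qed blast
  qed
  then show ?thesis
    by (simp add: k(1) add_ac)
qed

text \<open>Each step gives up \<open>r\<close> at both ends of the window, so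
  \<open>R + r * length steps\<close> at the start leaves \<open>R\<close> at the end. The bound
  \<open>M\<close> on all windows makes the cost per step uniform.\<close>

lemma sa_extends_steps:
  assumes "\<And>st. st \<in> set steps \<Longrightarrow> valid_step p n H w r st"
    and "sa_proof V H \<pi>" "0 \<in> set \<pi>" "gaps p n c t (R + r * length steps) \<subseteq> set \<pi>"
    and "R + r * length steps \<le> M"
  shows "\<exists>\<rho>. sa_extends V H L \<pi> (length steps * ((2 * M + 1) * (S * (w + 4)))) \<rho> \<and>
    gaps p n (c + (\<Sum>(I, c', t')\<leftarrow>steps. c')) (\<lambda>i. t i + (\<Sum>(I, c', t')\<leftarrow>steps. t' i)) R \<subseteq> set (\<pi> @ \<rho>)"
  using assms
proof (induction steps arbitrary: \<pi> c t)
  case Nil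
  then show ?case
    by (auto intro!: exI[of _ "[]"] sa_extends_Nil)
next
  case (Cons st steps)
  obtain I c' t' where st: "st = (I, c', t')"
    by (cases st)
  let ?R = "R + r * length steps" and ?c = "c + c'" and ?t = "\<lambda>i. t i + t' i"
  let ?N = "(2 * M + 1) * (S * (w + 4))"
  have "\<exists>\<rho>. sa_extends V H L \<pi> (card (gaps p n ?c ?t ?R) * (S * (w + 2 + 2))) \<rho> \<and>
      gaps p n ?c ?t ?R \<subseteq> set (\<pi> @ \<rho>)"
  proof (rule sa_extends_certificate_set[OF finite_gaps, where K = K and e = 2])
    show "certificate V (H \<union> sa_axioms V \<union> gaps p n c t (?R + r)) (w + 2) S P"
      if "P \<in> gaps p n ?c ?t ?R" for P
      using Cons.prems(1)[of st] that st by (intro certificate_valid_step) auto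
  qed (use Cons.prems base_bounded in \<open>auto simp: add_ac\<close>)
  then obtain \<rho> where \<rho>: "sa_extends V H L \<pi> (card (gaps p n ?c ?t ?R) * (S * (w + 2 + 2))) \<rho>"
    "gaps p n ?c ?t ?R \<subseteq> set (\<pi> @ \<rho>)"
    by blast
  have "card (gaps p n ?c ?t ?R) \<le> 2 * M + 1"
    using card_gaps[of p n ?c ?t ?R] Cons.prems(5) by simp
  then have ext: "sa_extends V H L \<pi> ?N \<rho>"
    using \<rho>(1) by (elim sa_extends_mono) (intro mult_le_mono; simp)
  have "\<exists>\<rho>'. sa_extends V H L (\<pi> @ \<rho>) (length steps * ?N) \<rho>' \<and>
    gaps p n (?c + (\<Sum>(I, c', t')\<leftarrow>steps. c')) (\<lambda>i. ?t i + (\<Sum>(I, c', t')\<leftarrow>steps. t' i)) R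
      \<subseteq> set ((\<pi> @ \<rho>) @ \<rho>')"
    using Cons.prems \<rho> ext by (intro Cons.IH) (auto simp: sa_extends_def)
  then obtain \<rho>' where \<rho>': "sa_extends V H L (\<pi> @ \<rho>) (length steps * ?N) \<rho>'"
    "gaps p n (?c + (\<Sum>(I, c', t')\<leftarrow>steps. c')) (\<lambda>i. ?t i + (\<Sum>(I, c', t')\<leftarrow>steps. t' i)) R
      \<subseteq> set ((\<pi> @ \<rho>) @ \<rho>')"
    by blast
  show ?case
  proof (intro exI conjI)
    show "sa_extends V H L \<pi> (length (st # steps) * ?N) (\<rho> @ \<rho>')"
      using sa_extends_trans[OF ext \<rho>'(1)] by simp
    show "gaps p n (c + (\<Sum>(I, c', t')\<leftarrow>st # steps. c'))
        (\<lambda>i. t i + (\<Sum>(I, c', t')\<leftarrow>st # steps. t' i)) R \<subseteq> set (\<pi> @ \<rho> @ \<rho>')"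
      using \<rho>'(2) by (simp add: st add.assoc)
  qed
qed

lemma refutation_from_steps:
  assumes valid: "\<And>st. st \<in> set steps \<Longrightarrow> valid_step p n H w r st"
    and cancel: "\<And>i. (\<Sum>(I, c', t')\<leftarrow>steps. t' i) = 0"
    and f: "f = (\<Sum>(I, c', t')\<leftarrow>steps. c')" "f \<notin> \<int>" "\<bar>\<lfloor>f\<rfloor>\<bar> \<le> int R"
    and M: "R + r * length steps \<le> M"
  shows "\<exists>\<pi>. sa_refutation V H \<pi> \<and> set \<pi> \<subseteq> L \<and>
    length \<pi> \<le> (length steps + 1) * ((2 * M + 1) * (S * (w + 4))) + 3"
proof -
  let ?N = "(2 * M + 1) * (S * (w + 4))"
  let ?v = "(1, 0)" and ?R = "R + r * length steps"
  have v: "?v \<in> V"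
    using p_ge_2 n_ge_1 by (simp add: enc_vars_def)
  have "bounded_lines V 2 2 \<subseteq> L"
  proof (rule bounded_lines_mono)
    show "2 \<le> K * S"
      using mult_le_mono[OF K_ge_2 S_ge_2] by simp
  qed simp
  then have ax_L: "sa_axioms V \<subseteq> L"
    using sa_axioms_bounded by blast
  have "sa_extends V H L [] 1 [Var ?v]"
    using ax_L v sa_extends_snoc[OF sa_extends_Nil[of V H "[]" L 0], of "Var ?v"]
    by (auto simp: sa_axioms_def sa_proof_def)
  moreover have "sa_infers V (set ([] @ [Var ?v])) 0"
    using sa_infers.lin_comb[of "Var ?v" "{Var ?v}" "Var ?v" 0 0 V] by simp
  ultimately have \<pi>0: "sa_extends V H L [] 2 [Var ?v, 0]"
    using sa_extends_snoc[of V H L "[]" 1 "[Var ?v]" 0]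
    by (auto simp: bounded_lines_def numeral_2_eq_2)
  have "\<exists>\<rho>. sa_extends V H L [Var ?v, 0] (card (gaps p n 0 (\<lambda>_. 0) ?R) * (S * (w + 2 + 2))) \<rho> \<and>
      gaps p n 0 (\<lambda>_. 0) ?R \<subseteq> set ([Var ?v, 0] @ \<rho>)"
  proof (rule sa_extends_certificate_set[OF finite_gaps, where K = K and e = 2])
    interpret base: zp_encoding p n "H \<union> sa_axioms V \<union> {}"
      using p_ge_2 n_ge_1 enc_Z_H by unfold_locales auto
    fix P assume "P \<in> gaps p n 0 (\<lambda>_. 0) ?R"
    then obtain k where "P = gap p n (of_int k) (\<lambda>_. 0)"
      by (auto simp: gaps_def)
    then have P: "P = Const (of_int (k * (k - 1))) * 1"
      by (simp add: gap_def affine_zero Const_mult Const_diff)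
    \<comment> \<open>No integer lies strictly between 0 and 1, so the gap polynomials of the zero
      form are nonnegative constants.\<close>
    have "0 \<le> k * (k - 1)"
      by (cases "k \<le> 0") (auto intro: mult_nonpos_nonpos)
    then have "(0::rat) \<le> of_int (k * (k - 1))"
      by (simp only: of_int_0_le_iff)
    with base.certificate_one have "certificate V (H \<union> sa_axioms V \<union> {}) 0 2 P"
      unfolding P by (rule certificate_Const_mult)
    then show "certificate V (H \<union> sa_axioms V \<union> {}) (w + 2) S P"
      using S_ge_2 by (elim certificate_mono) auto
  qed (use \<pi>0 base_bounded in \<open>auto simp: sa_extends_def\<close>)
  then obtain \<rho>1 where \<rho>1: "sa_extends V H L [Var ?v, 0] (card (gaps p n 0 (\<lambda>_. 0) ?R) * (S * (w + 2 + 2))) \<rho>1"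
    "gaps p n 0 (\<lambda>_. 0) ?R \<subseteq> set ([Var ?v, 0] @ \<rho>1)"
    by blast
  have "card (gaps p n 0 (\<lambda>_. 0) ?R) \<le> 2 * M + 1"
    using card_gaps[of p n 0 "\<lambda>_. 0" ?R] M by simp
  then have "sa_extends V H L [Var ?v, 0] ?N \<rho>1"
    using \<rho>1(1) by (elim sa_extends_mono) (intro mult_le_mono; simp)
  with \<pi>0 have \<pi>1: "sa_extends V H L [] (2 + ?N) ([Var ?v, 0] @ \<rho>1)"
    using sa_extends_trans[of V H L "[]" 2 "[Var ?v, 0]"] by simp
  have "\<exists>\<rho>. sa_extends V H L ([Var ?v, 0] @ \<rho>1) (length steps * ?N) \<rho> \<and>
      gaps p n (0 + (\<Sum>(I, c', t')\<leftarrow>steps. c')) (\<lambda>i. 0 + (\<Sum>(I, c', t')\<leftarrow>steps. t' i)) R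
        \<subseteq> set (([Var ?v, 0] @ \<rho>1) @ \<rho>)"
    using \<pi>1 \<rho>1(2) by (intro sa_extends_steps[OF valid _ _ _ M]) (auto simp: sa_extends_def)
  then obtain \<rho>2 where \<rho>2: "sa_extends V H L ([Var ?v, 0] @ \<rho>1) (length steps * ?N) \<rho>2"
    "gaps p n f (\<lambda>_. 0) R \<subseteq> set (([Var ?v, 0] @ \<rho>1) @ \<rho>2)"
    by (auto simp: cancel f(1))
  define \<pi> where "\<pi> = ([Var ?v, 0] @ \<rho>1) @ \<rho>2"
  have \<pi>: "sa_extends V H L [] (2 + ?N + length steps * ?N) \<pi>"
    using sa_extends_trans[OF \<pi>1] \<rho>2(1) by (simp add: \<pi>_def)
  \<comment> \<open>The shift moves \<open>f\<close> to its fractional part, strictly between 0 and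
    1, where the gap polynomial is negative. Scaling by \<open>- 1 / q\<close> then yields
    -1.\<close>
  define q where "q = frac f * (frac f - 1)"
  have "gap p n (f + of_int (- \<lfloor>f\<rfloor>)) (\<lambda>_. 0) = Const q"
    by (simp add: q_def gap_def affine_zero frac_def Const_mult Const_diff)
  moreover have "gap p n (f + of_int (- \<lfloor>f\<rfloor>)) (\<lambda>_. 0) \<in> gaps p n f (\<lambda>_. 0) R"
    unfolding gaps_def using f(3) by (intro imageI) auto
  ultimately have q_in: "Const q \<in> set \<pi>"
    using \<rho>2(2) by (auto simp: \<pi>_def)
  have "q < 0"
    using f(2) frac_lt_1[of f] by (auto simp: q_def frac_gt_0_iff intro: mult_pos_neg)
  have "Const (- 1 / q) * Const q + Const 0 * Const q = (- 1 :: enc_var rpoly)"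
    using \<open>q < 0\<close> by (simp add: Const_uminus flip: Const_mult)
  then have "sa_infers V (set \<pi>) (- 1)"
    using sa_infers.lin_comb[OF q_in q_in, of "- 1 / q" 0] \<open>q < 0\<close> by (simp add: divide_nonpos_neg)
  moreover have "- 1 \<in> L"
    using K_ge_2 S_ge_2 by (simp add: bounded_lines_def polys_uminus)
  ultimately have "sa_extends V H L [] (Suc (2 + ?N + length steps * ?N)) (\<pi> @ [- 1])"
    using sa_extends_snoc[OF \<pi>] by simp
  then show ?thesis
    by (intro exI[of _ "\<pi> @ [- 1]"]) (auto simp: sa_extends_def sa_refutation_def)
qed

end

section \<open>Sparse linear combinations witnessing unsatisfiability\<close>

text \<open>Gaussian elimination of one unknown per induction step. Only the pivot row is added to
  the combination in each step, so its length does not depend on the number of rows.\<close>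

lemma unsatisfiable_combination:
  fixes A :: "'j \<Rightarrow> nat \<Rightarrow> int" and b :: "'j \<Rightarrow> int"
  assumes "prime p" "\<nexists>x. \<forall>j\<in>J. p dvd (\<Sum>i=1..n. A j i * x i) - b j"
  shows "\<exists>ys. length ys \<le> n + 1 \<and> fst ` set ys \<subseteq> J \<and>
    (\<forall>i\<in>{1..n}. p dvd (\<Sum>(j, y)\<leftarrow>ys. y * A j i)) \<and> \<not> p dvd (\<Sum>(j, y)\<leftarrow>ys. y * b j)"
  using assms(2)
proof (induction n arbitrary: A b)
  case 0
  then obtain j where "j \<in> J" "\<not> p dvd b j"
    by auto
  then show ?case
    by (intro exI[of _ "[(j, 1)]"]) auto
next
  case (Suc n)
  show ?case
  proof (cases "\<forall>j\<in>J. p dvd A j (Suc n)")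
    case True
    have "\<nexists>x. \<forall>j\<in>J. p dvd (\<Sum>i=1..n. A j i * x i) - b j"
    proof
      assume "\<exists>x. \<forall>j\<in>J. p dvd (\<Sum>i=1..n. A j i * x i) - b j"
      then obtain x where x: "\<forall>j\<in>J. p dvd (\<Sum>i=1..n. A j i * x i) - b j"
        by blast
      have "p dvd (\<Sum>i=1..Suc n. A j i * x i) - b j" if "j \<in> J" for j
      proof -
        have "p dvd ((\<Sum>i=1..n. A j i * x i) - b j) + A j (Suc n) * x (Suc n)"
          using x True that by (intro dvd_add dvd_mult2) auto
        then show ?thesis
          by (simp add: algebra_simps)
      qed
      with Suc.prems show False
        by blast
    qed
    from Suc.IH[OF this] obtain ys where ys: "length ys \<le> n + 1" "fst ` set ys \<subseteq> J"
      "\<forall>i\<in>{1..n}. p dvd (\<Sum>(j, y)\<leftarrow>ys. y * A j i)" "\<not> p dvd (\<Sum>(j, y)\<leftarrow>ys. y * b j)"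
      by blast
    have "p dvd (\<Sum>(j, y)\<leftarrow>ys. y * A j (Suc n))"
      using ys(2) True by (induction ys) (auto intro!: dvd_add)
    then show ?thesis
      using ys by (intro exI[of _ ys]) (auto simp: le_Suc_eq)
  next
    case False
    then obtain j0 where j0: "j0 \<in> J" "\<not> p dvd A j0 (Suc n)"
      by blast
    define d where "d = A j0 (Suc n)"
    \<comment> \<open>Cross-multiplication with the pivot row removes the last unknown without
      division, so all coefficients stay integers.\<close>
    define A' where "A' j i = d * A j i - A j (Suc n) * A j0 i" for j i
    define b' where "b' j = d * b j - A j (Suc n) * b j0" for j
    have "\<nexists>x. \<forall>j\<in>J. p dvd (\<Sum>i=1..n. A' j i * x i) - b' j"
    proof
      assume "\<exists>x. \<forall>j\<in>J. p dvd (\<Sum>i=1..n. A' j i * x i) - b' j"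
      then obtain x where x: "\<forall>j\<in>J. p dvd (\<Sum>i=1..n. A' j i * x i) - b' j"
        by blast
      have "coprime d p"
        using assms(1) j0 prime_imp_coprime[of p d] by (simp add: d_def coprime_commute)
      then obtain e where "[d * e = 1] (mod p)"
        using cong_solve_coprime_int[of d p] by blast
      then have e: "p dvd d * e - 1"
        by (simp add: cong_iff_dvd_diff)
      \<comment> \<open>The last unknown is chosen to solve the pivot row: \<open>r\<close> is what
        remains of its right-hand side, and \<open>e\<close> inverts the pivot \<open>d\<close>
        modulo \<open>p\<close>.\<close>
      define r where "r = b j0 - (\<Sum>i=1..n. A j0 i * x i)"
      define y where "y = x(Suc n := e * r)"
      have y_sum: "(\<Sum>i=1..Suc n. A j i * y i) = (\<Sum>i=1..n. A j i * x i) + A j (Suc n) * (e * r)" for j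
        by (simp add: y_def)
      have "(\<Sum>i=1..Suc n. A j0 i * y i) - b j0 = (d * e - 1) * r"
        unfolding y_sum r_def d_def by (simp add: algebra_simps)
      then have y0: "p dvd (\<Sum>i=1..Suc n. A j0 i * y i) - b j0"
        using e by simp
      have "p dvd (\<Sum>i=1..Suc n. A j i * y i) - b j" if "j \<in> J" for j
      proof -
        \<comment> \<open>The original row times \<open>d\<close> is the eliminated row plus a
          multiple of the pivot row; \<open>d\<close> cancels because \<open>p\<close> does not
          divide it.\<close>
        have "d * ((\<Sum>i=1..Suc n. A j i * y i) - b j) =
            ((\<Sum>i=1..n. A' j i * x i) - b' j) + A j (Suc n) * ((\<Sum>i=1..Suc n. A j0 i * y i) - b j0)"
          unfolding y_sum A'_def b'_def
          by (simp add: algebra_simps sum_subtractf sum_distrib_left d_def)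
        moreover have "p dvd \<dots>"
          using x that y0 by (intro dvd_add dvd_mult) auto
        ultimately have "p dvd d * ((\<Sum>i=1..Suc n. A j i * y i) - b j)"
          by simp
        then show ?thesis
          using prime_dvd_mult_iff[OF assms(1)] j0 d_def by blast
      qed
      with Suc.prems show False
        by blast
    qed
    from Suc.IH[OF this] obtain ys where ys: "length ys \<le> n + 1" "fst ` set ys \<subseteq> J"
      "\<forall>i\<in>{1..n}. p dvd (\<Sum>(j, y)\<leftarrow>ys. y * A' j i)" "\<not> p dvd (\<Sum>(j, y)\<leftarrow>ys. y * b' j)"
      by blast
    \<comment> \<open>The combination of eliminated rows is pulled back to the original ones:
      multipliers are scaled by \<open>d\<close>, and all subtracted copies of the pivot row are
      collected in one entry.\<close>
    define zs where
      "zs = (j0, - (\<Sum>(j, y)\<leftarrow>ys. y * A j (Suc n))) # map (\<lambda>(j, y). (j, d * y)) ys"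
    have zs_sum: "(\<Sum>(j, y)\<leftarrow>zs. y * f j) = (\<Sum>(j, y)\<leftarrow>ys. y * (d * f j - A j (Suc n) * f j0))" for f
      unfolding zs_def by (induction ys) (auto simp: algebra_simps)
    have "(\<Sum>(j, y)\<leftarrow>zs. y * A j (Suc n)) = 0"
      unfolding zs_sum by (induction ys) (auto simp: d_def algebra_simps)
    then have "p dvd (\<Sum>(j, y)\<leftarrow>zs. y * A j i)" if "i \<in> {1..Suc n}" for i
      using that ys(3) zs_sum[of "\<lambda>j. A j i"] by (cases "i = Suc n") (auto simp: A'_def)
    moreover have "\<not> p dvd (\<Sum>(j, y)\<leftarrow>zs. y * b j)"
      using ys(4) zs_sum[of b] by (simp add: b'_def)
    moreover have "length zs \<le> Suc n + 1" "fst ` set zs \<subseteq> J"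
      using ys j0 by (auto simp: zs_def)
    ultimately show ?thesis
      by blast
  qed
qed

text \<open>Divisibility by \<open>p\<close> survives reducing the multipliers modulo
  \<open>p\<close>, and small multipliers keep the values of the row forms, hence the windows,
  polynomial.\<close>

lemma unsatisfiable_combination_reduced:
  fixes A :: "'j \<Rightarrow> nat \<Rightarrow> int" and b :: "'j \<Rightarrow> int"
  assumes "prime p" "\<nexists>x. \<forall>j\<in>J. p dvd (\<Sum>i=1..n. A j i * x i) - b j"
  obtains ys where "length ys \<le> n + 1" "\<And>j y. (j, y) \<in> set ys \<Longrightarrow> j \<in> J \<and> 0 \<le> y \<and> y < p"
    "\<And>i. i \<in> {1..n} \<Longrightarrow> p dvd (\<Sum>(j, y)\<leftarrow>ys. y * A j i)" "\<not> p dvd (\<Sum>(j, y)\<leftarrow>ys. y * b j)"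
proof -
  obtain ys where ys: "length ys \<le> n + 1" "fst ` set ys \<subseteq> J"
    "\<forall>i\<in>{1..n}. p dvd (\<Sum>(j, y)\<leftarrow>ys. y * A j i)" "\<not> p dvd (\<Sum>(j, y)\<leftarrow>ys. y * b j)"
    using unsatisfiable_combination[OF assms] by blast
  define zs where "zs = map (\<lambda>(j, y). (j, y mod p)) ys"
  have "[(\<Sum>(j, y)\<leftarrow>zs. y * f j) = (\<Sum>(j, y)\<leftarrow>ys. y * f j)] (mod p)" for f
    unfolding zs_def by (induction ys) (auto intro!: cong_add cong_scalar_right)
  then have dvd: "p dvd (\<Sum>(j, y)\<leftarrow>zs. y * f j) \<longleftrightarrow> p dvd (\<Sum>(j, y)\<leftarrow>ys. y * f j)" for f
    by (rule cong_dvd_iff)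
  have "0 < p"
    using assms(1) by (simp add: prime_gt_0_int)
  show ?thesis
  proof (rule that)
    show "length zs \<le> n + 1"
      using ys(1) by (simp add: zs_def)
    show "j \<in> J \<and> 0 \<le> y \<and> y < p" if "(j, y) \<in> set zs" for j y
      using that ys(2) \<open>0 < p\<close> by (force simp: zs_def)
    show "p dvd (\<Sum>(j, y)\<leftarrow>zs. y * A j i)" if "i \<in> {1..n}" for i
      using that ys(3) by (simp add: dvd[of "\<lambda>j. A j i"])
    show "\<not> p dvd (\<Sum>(j, y)\<leftarrow>zs. y * b j)"
      using ys(4) by (simp add: dvd)
  qed
qed

section \<open>Refuting the linear system\<close>

lemma card_row_supp: "card (row_supp n a) \<le> n"
proof -
  have "row_supp n a \<subseteq> {1..n}"
    by (auto simp: row_supp_def)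
  from card_mono[OF _ this] show ?thesis
    by simp
qed

text \<open>The form is y (a X - b) / p. At an assignment that no hypothesis excludes, a z - b is a
  multiple q p with |q| at most (n + 1) p, so the value y q is an integer of absolute value at most
  (n + 1) p^2.\<close>

lemma valid_row_step:
  assumes "0 < p" "0 \<le> y" "y < int p" "b < p" "\<And>i. i \<in> {1..n} \<Longrightarrow> a i < p"
    and "card (row_supp n a) \<le> w" "enc_row p n a b \<subseteq> H"
  shows "valid_step p n H w ((n + 1) * p\<^sup>2) (row_supp n a, - (of_int y * of_nat b / of_nat p),
    \<lambda>i. if i \<in> row_supp n a then of_int y * of_nat (a i) / of_nat p else 0)"
proof -
  let ?I = "row_supp n a" and ?t = "\<lambda>i. if i \<in> row_supp n a then of_int y * of_nat (a i) / of_nat p else (0::rat)"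
  have I: "?I \<subseteq> {1..n}"
    by (auto simp: row_supp_def)
  have "exclusion ?I z \<in> H \<or> (\<exists>k::int. - (of_int y * of_nat b / of_nat p) + (\<Sum>i\<in>?I. ?t i * of_nat (z i)) = of_int k \<and>
      \<bar>k\<bar> \<le> int ((n + 1) * p\<^sup>2))" if z: "z \<in> ?I \<rightarrow>\<^sub>E {..<p}" for z
  proof (cases "[(\<Sum>i\<in>?I. a i * z i) = b] (mod p)")
    case False
    then have "exclusion ?I z \<in> enc_row p n a b"
      using z by (auto simp: enc_row_def exclusion_def)
    then show ?thesis
      using assms(7) by blast
  next
    case True
    define T where "T = (\<Sum>i\<in>?I. a i * z i)"
    have "int p dvd int T - int b"
      using True by (simp add: T_def cong_iff_dvd_diff flip: cong_int_iff)
    then obtain q where q: "int T - int b = int p * q"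
      by (elim dvdE)
    have "a i * z i \<le> p * p" if "i \<in> ?I" for i
      using that z assms(5)[of i] I by (intro mult_le_mono) (auto intro: less_imp_le)
    then have "T \<le> card ?I * (p * p)"
      unfolding T_def using sum_bounded_above[of ?I "\<lambda>i. a i * z i" "p * p"] by simp
    also have "\<dots> \<le> n * (p * p)"
      by (intro mult_le_mono1 card_row_supp)
    finally have "T \<le> (n + 1) * (p * p)"
      by simp
    moreover have "b \<le> (n + 1) * (p * p)"
      using assms(1,4) mult_le_mono[of 1 "n + 1" b "p * p"] mult_le_mono[of 1 p b p] by simp
    ultimately have "\<bar>int T - int b\<bar> \<le> int ((n + 1) * (p * p))"
      by linarith
    then have "int p * \<bar>q\<bar> \<le> int p * int ((n + 1) * p)"
      unfolding q by (simp add: abs_mult algebra_simps)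
    then have "\<bar>q\<bar> \<le> int ((n + 1) * p)"
      using assms(1) mult_le_cancel_left_pos[of "int p"] by simp
    moreover have "\<bar>y\<bar> \<le> int p"
      using assms by simp
    ultimately have "\<bar>y\<bar> * \<bar>q\<bar> \<le> int p * int ((n + 1) * p)"
      by (intro mult_mono) auto
    then have bound: "\<bar>y * q\<bar> \<le> int ((n + 1) * p\<^sup>2)"
      by (simp add: abs_mult power2_eq_square algebra_simps)
    have "(\<Sum>i\<in>?I. ?t i * of_nat (z i)) = of_int y * of_nat T / of_nat p"
      by (simp add: T_def sum_distrib_left sum_divide_distrib mult.assoc)
    then have "- (of_int y * of_nat b / of_nat p) + (\<Sum>i\<in>?I. ?t i * of_nat (z i)) =
        of_int y * of_int (int T - int b) / of_nat p"
      using assms(1) by (simp add: field_simps)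
    also have "\<dots> = of_int (y * q)"
      unfolding q using assms(1) by simp
    finally show ?thesis
      using bound by blast
  qed
  then show ?thesis
    using I assms(6) by simp
qed

text \<open>An integer multiple of one unknown is integral under each of its \<open>p\<close>
  values, so no assignment has to be excluded. The support \<open>{i}\<close> is what requires
  \<open>1 \<le> w\<close>.\<close>

lemma valid_unknown_step:
  assumes "i \<in> {1..n}" "\<bar>k\<bar> \<le> int ((n + 1) * p)" "1 \<le> w"
  shows "valid_step p n H w ((n + 1) * p\<^sup>2) ({i}, 0, \<lambda>i'. if i' = i then of_int k else 0)"
proof -
  have "\<bar>k * int (z i)\<bar> \<le> int ((n + 1) * p\<^sup>2)" if "z \<in> {i} \<rightarrow>\<^sub>E {..<p}" for z
  proof -
    have "z i < p"
      using that by auto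
    then have "\<bar>k\<bar> * int (z i) \<le> int ((n + 1) * p) * int p"
      using assms(2) by (intro mult_mono) auto
    then show ?thesis
      by (simp add: abs_mult power2_eq_square algebra_simps)
  qed
  moreover have "0 + (\<Sum>i'\<in>{i}. (if i' = i then of_int k else 0) * of_nat (z i')) =
      (of_int (k * int (z i)) :: rat)" for z :: "nat \<Rightarrow> nat"
    by simp
  ultimately show ?thesis
    using assms unfolding valid_step.simps by (intro conjI allI ballI disjI2 exI) auto
qed

section \<open>Sparsity of the hypotheses and passage to the integers\<close>

lemma enc_Z_bounded: "enc_Z p n \<subseteq> bounded_lines (enc_vars p n) (p + 1) 2"
proof -
  have m: "mons (\<Sum>l<p. Var (i, l)) \<le> p" for i :: nat
    using mons_sum[of "{..<p}" "\<lambda>l. Var (i, l)" 1, OF mons_Var] by simp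
  have "(\<Sum>l<p. Var (i, l)) \<in> polys (enc_vars p n) 2" if "i \<in> {1..n}" for i
    using that by (intro polys_sum polys_Var) (auto simp: enc_vars_def)
  moreover have "mons ((\<Sum>l<p. Var (i, l)) - 1) \<le> p + 1" for i :: nat
    using mons_diff[of "\<Sum>l<p. Var (i, l)" 1] m[of i] by simp
  moreover have "mons (1 - (\<Sum>l<p. Var (i, l))) \<le> p + 1" for i :: nat
    using mons_diff[of 1 "\<Sum>l<p. Var (i, l)"] m[of i] by simp
  ultimately show ?thesis
    by (auto simp: enc_Z_def bounded_lines_def intro!: polys_diff)
qed

lemma enc_row_bounded: "enc_row p n a b \<subseteq> bounded_lines (enc_vars p n) (2 * n + 1) 2"
proof
  fix P assume "P \<in> enc_row p n a b"
  then obtain z where z: "z \<in> row_supp n a \<rightarrow>\<^sub>E {..<p}"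
    and P: "P = (\<Sum>i\<in>row_supp n a. 1 - Var (i, z i)) - 1"
    by (auto simp: enc_row_def)
  have "mons (1 - Var (i, z i)) \<le> 2" for i
    using mons_diff[of 1 "Var (i, z i)"] mons_Var[of "(i, z i)"] by simp
  then have "mons (\<Sum>i\<in>row_supp n a. 1 - Var (i, z i)) \<le> card (row_supp n a) * 2"
    by (intro mons_sum)
  also have "\<dots> \<le> n * 2"
    by (intro mult_le_mono1 card_row_supp)
  finally have "mons P \<le> 2 * n + 1"
    using mons_diff[of "\<Sum>i\<in>row_supp n a. 1 - Var (i, z i)" 1] by (simp add: P)
  moreover have "P \<in> polys (enc_vars p n) 2"
    unfolding P using z
    by (intro polys_diff polys_sum polys_Var polys_1) (auto simp: enc_vars_def row_supp_def PiE_iff)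
  ultimately show "P \<in> bounded_lines (enc_vars p n) (2 * n + 1) 2"
    by (simp add: bounded_lines_def)
qed

lemma unsatisfiable_int:
  assumes "0 < p" "\<not> lin_satisfiable p m n A b"
  shows "\<nexists>x. \<forall>j\<in>{1..m}. int p dvd (\<Sum>i=1..n. int (A j i) * x i) - int (b j)"
proof
  assume "\<exists>x. \<forall>j\<in>{1..m}. int p dvd (\<Sum>i=1..n. int (A j i) * x i) - int (b j)"
  then obtain x where x: "\<forall>j\<in>{1..m}. int p dvd (\<Sum>i=1..n. int (A j i) * x i) - int (b j)"
    by blast
  define x' where "x' i = nat (x i mod int p)" for i
  have x': "int (x' i) = x i mod int p" for i
    using assms(1) by (simp add: x'_def)
  have "[(\<Sum>i=1..n. A j i * x' i) = b j] (mod p)" if "j \<in> {1..m}" for j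
  proof -
    have "[(\<Sum>i=1..n. int (A j i) * int (x' i)) = (\<Sum>i=1..n. int (A j i) * x i)] (mod int p)"
      unfolding x' by (intro cong_sum cong_scalar_left) simp
    also have "[(\<Sum>i=1..n. int (A j i) * x i) = int (b j)] (mod int p)"
      using x that by (simp add: cong_iff_dvd_diff)
    finally have "[int (\<Sum>i=1..n. A j i * x' i) = int (b j)] (mod int p)"
      by simp
    then show ?thesis
      by (simp only: cong_int_iff)
  qed
  moreover have "x' i < p" for i
    using x'[of i] assms(1) pos_mod_bound[of "int p" "x i"] by linarith
  ultimately show False
    using assms(2) unfolding lin_satisfiable_def by blast
qed

text \<open>At most \<open>n + 1\<close> row steps and \<open>n\<close> steps for the unknowns,
  together with the initial window, give the factor \<open>2 * n + 2\<close>. The final window has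
  radius \<open>(n + 1) * p\<close>, enough for the floor of the final constant; each of the at most
  \<open>2 * n + 1\<close> steps costs \<open>(n + 1) * p^2\<close> more.\<close>

lemma refutation_exists:
  fixes A :: "nat \<Rightarrow> nat \<Rightarrow> nat"
  assumes "prime p" "1 \<le> n" "1 \<le> w" and A: "\<And>j i. j \<in> {1..m} \<Longrightarrow> i \<in> {1..n} \<Longrightarrow> A j i < p"
    and b: "\<And>j. j \<in> {1..m} \<Longrightarrow> b j < p"
    and w: "\<And>j. j \<in> {1..m} \<Longrightarrow> card (row_supp n (A j)) \<le> w"
    and unsat: "\<not> lin_satisfiable p m n A b"
  shows "\<exists>\<pi>. sa_refutation (enc_vars p n) (enc_system p m n A b \<union> enc_Z p n) \<pi> \<and>
    set \<pi> \<subseteq> bounded_lines (enc_vars p n) ((n * p + 1)\<^sup>2 * step_size p n w) (w + 4) \<and>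
    length \<pi> \<le> (2 * n + 2) *
      ((2 * ((n + 1) * p + (n + 1) * p\<^sup>2 * (2 * n + 1)) + 1) * (step_size p n w * (w + 4))) + 3"
proof -
  let ?H = "enc_system p m n A b \<union> enc_Z p n"
  let ?r = "(n + 1) * p\<^sup>2" and ?R = "(n + 1) * p"
  have p: "2 \<le> p" "0 < p"
    using assms(1) prime_ge_2_nat[of p] by auto
  obtain ys where ys: "length ys \<le> n + 1"
    "\<And>j y. (j, y) \<in> set ys \<Longrightarrow> j \<in> {1..m} \<and> 0 \<le> y \<and> y < int p"
    "\<And>i. i \<in> {1..n} \<Longrightarrow> int p dvd (\<Sum>(j, y)\<leftarrow>ys. y * int (A j i))"
    "\<not> int p dvd (\<Sum>(j, y)\<leftarrow>ys. y * int (b j))"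
    by (rule unsatisfiable_combination_reduced[OF _ unsatisfiable_int[OF p(2) unsat]])
      (use assms(1) in auto)
  have sum_bound: "0 \<le> (\<Sum>(j, y)\<leftarrow>ys. y * int (g j)) \<and>
      (\<Sum>(j, y)\<leftarrow>ys. y * int (g j)) \<le> int ((n + 1) * p) * int p"
    if g: "\<And>j. j \<in> {1..m} \<Longrightarrow> g j < p" for g
  proof -
    have "0 \<le> (\<Sum>(j, y)\<leftarrow>ys. y * int (g j)) \<and>
        (\<Sum>(j, y)\<leftarrow>ys. y * int (g j)) \<le> int (length ys) * (int p * int p)"
      using ys(2)
    proof (induction ys)
      case (Cons a ys)
      obtain j y where a: "a = (j, y)"
        by (cases a)
      have jy: "j \<in> {1..m}" "0 \<le> y" "y < int p"
        using Cons.prems[of j y] a by auto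
      then have "0 \<le> y * int (g j)" "y * int (g j) \<le> int p * int p"
        using g[of j] by (auto intro!: mult_mono)
      with Cons show ?case
        by (fastforce simp: a algebra_simps)
    qed simp
    moreover have "int (length ys) * (int p * int p) \<le> int (n + 1) * (int p * int p)"
      using ys(1) by (intro mult_right_mono) auto
    ultimately show ?thesis
      by (simp add: algebra_simps)
  qed
  \<comment> \<open>The exact quotient, negated: adding \<open>k i\<close> times unknown
    \<open>i\<close> cancels its coefficient in the sum of the row forms.\<close>
  define k where "k i = - ((\<Sum>(j, y)\<leftarrow>ys. y * int (A j i)) div int p)" for i
  have k: "(\<Sum>(j, y)\<leftarrow>ys. y * int (A j i)) = - (int p * k i)" if "i \<in> {1..n}" for i
    using ys(3)[OF that] by (simp add: k_def)
  have k_bound: "\<bar>k i\<bar> \<le> int ((n + 1) * p)" if i: "i \<in> {1..n}" for i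
  proof -
    have "int p * \<bar>k i\<bar> = \<bar>\<Sum>(j, y)\<leftarrow>ys. y * int (A j i)\<bar>"
      using k[OF i] by (simp add: abs_mult)
    also have "\<dots> \<le> int p * int ((n + 1) * p)"
      using sum_bound[of "\<lambda>j. A j i"] A i by (auto simp: mult.commute)
    finally show ?thesis
      using p(2) mult_le_cancel_left_pos[of "int p"] by simp
  qed
  define row where "row = (\<lambda>(j, y). (row_supp n (A j), - (of_int y * of_nat (b j) / of_nat p) :: rat,
    \<lambda>i. if i \<in> row_supp n (A j) then of_int y * of_nat (A j i) / of_nat p else (0::rat)))"
  define col where "col i = ({i}, 0::rat, \<lambda>i'. if i' = i then of_int (k i) else (0::rat))" for i
  define steps where "steps = map row ys @ map col [1..<n + 1]"
  define f where "f = (\<Sum>(I, c', t')\<leftarrow>steps. c')"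
  have len: "length steps \<le> 2 * n + 1"
    using ys(1) by (simp add: steps_def)
  have valid: "valid_step p n ?H w ?r st" if "st \<in> set steps" for st
  proof -
    consider j y where "(j, y) \<in> set ys" "st = row (j, y)" | i where "i \<in> {1..n}" "st = col i"
      using \<open>st \<in> set steps\<close> by (fastforce simp: steps_def less_Suc_eq_le simp del: upt_Suc)
    then show ?thesis
    proof cases
      case 1
      then have j: "j \<in> {1..m}" "0 \<le> y" "y < int p"
        using ys(2) by auto
      have "enc_row p n (A j) (b j) \<subseteq> ?H"
        using j(1) by (auto simp: enc_system_def)
      with 1 j p show ?thesis
        unfolding row_def by (auto simp only: prod.case intro!: valid_row_step A b w)
    next
      case 2
      then show ?thesis
        unfolding col_def using k_bound assms(3) by (auto simp only: intro!: valid_unknown_step)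
    qed
  qed
  have row_sum: "(\<Sum>(I, c', t')\<leftarrow>map row ys. t' i) = of_int (\<Sum>(j, y)\<leftarrow>ys. y * int (A j i)) / of_nat p"
    if "i \<in> {1..n}" for i
    using that by (induction ys) (auto simp: row_def row_supp_def add_divide_distrib)
  have row_sum_0: "(\<Sum>(I, c', t')\<leftarrow>map row ys. t' i) = 0" if "i \<notin> {1..n}" for i
    using that by (induction ys) (auto simp: row_def row_supp_def)
  have "(\<Sum>(I, c', t')\<leftarrow>map col [1..<n + 1]. t' i) = (\<Sum>i'\<leftarrow>[1..<n + 1]. if i' = i then of_int (k i') else 0)" for i
    by (simp add: col_def comp_def eq_commute[of i] del: upt_Suc)
  then have col_sum: "(\<Sum>(I, c', t')\<leftarrow>map col [1..<n + 1]. t' i) = (if i \<in> {1..n} then of_int (k i) else 0)" for i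
    by (simp add: interv_sum_list_conv_sum_set_nat less_Suc_eq_le del: upt_Suc)
  have cancel: "(\<Sum>(I, c', t')\<leftarrow>steps. t' i) = 0" for i
  proof (cases "i \<in> {1..n}")
    case True
    then show ?thesis
      using row_sum[OF True] k[OF True] p(2) unfolding steps_def map_append sum_list_append col_sum by simp
  next
    case False
    then show ?thesis
      using row_sum_0[OF False] unfolding steps_def map_append sum_list_append col_sum by auto
  qed
  have "(\<Sum>(I, c', t')\<leftarrow>map row ys. c') = - (of_int (\<Sum>(j, y)\<leftarrow>ys. y * int (b j)) / of_nat p)"
    by (induction ys) (auto simp: row_def add_divide_distrib)
  moreover have "(\<Sum>(I, c', t')\<leftarrow>map col [1..<n + 1]. c') = 0"
    by (simp add: col_def comp_def del: upt_Suc)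
  ultimately have f: "f = - (of_int (\<Sum>(j, y)\<leftarrow>ys. y * int (b j)) / of_nat p)"
    by (simp add: f_def steps_def del: upt_Suc)
  have f_nonint: "f \<notin> \<int>"
  proof
    assume "f \<in> \<int>"
    then obtain l where "f = of_int l"
      by (elim Ints_cases)
    then have "(of_int (\<Sum>(j, y)\<leftarrow>ys. y * int (b j)) :: rat) = of_int (int p * (- l))"
      using f p(2) by (simp add: field_simps)
    then have "(\<Sum>(j, y)\<leftarrow>ys. y * int (b j)) = int p * (- l)"
      by (simp only: of_int_eq_iff)
    then show False
      using ys(4) by simp
  qed
  have "\<bar>\<lfloor>f\<rfloor>\<bar> \<le> int ?R"
  proof -
    let ?s = "\<Sum>(j, y)\<leftarrow>ys. y * int (b j)"
    have s: "0 \<le> ?s" "?s \<le> int ?R * int p"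
      using sum_bound[of b] b by auto
    have "(of_int ?s :: rat) \<le> of_int (int ?R * int p)"
      using s(2) by (simp only: of_int_le_iff)
    then have "(of_int ?s :: rat) \<le> of_nat ?R * of_nat p"
      by simp
    then have "(of_int ?s / of_nat p :: rat) \<le> of_nat ?R"
      using p(2) by (subst pos_divide_le_eq) auto
    then have "of_int (- int ?R) \<le> f"
      unfolding f by simp
    then have "- int ?R \<le> \<lfloor>f\<rfloor>"
      by (simp only: le_floor_iff)
    moreover have "f \<le> 0"
      unfolding f using s(1) by simp
    ultimately show ?thesis
      by (auto simp: abs_le_iff)
  qed
  moreover interpret bounded_hypotheses p n w "(n * p + 1)\<^sup>2" ?H
  proof
    have K: "2 * n + 1 \<le> (n * p + 1)\<^sup>2" "p + 1 \<le> (n * p + 1)\<^sup>2"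
    proof -
      have "2 * n \<le> n * p" "p \<le> n * p"
        using p assms(2) by auto
      moreover have "n * p + 1 \<le> (n * p + 1)\<^sup>2"
        by (simp add: power2_eq_square)
      ultimately show "2 * n + 1 \<le> (n * p + 1)\<^sup>2" "p + 1 \<le> (n * p + 1)\<^sup>2"
        by linarith+
    qed
    show "?H \<subseteq> bounded_lines (enc_vars p n) ((n * p + 1)\<^sup>2) 2"
      using enc_Z_bounded[of p n] enc_row_bounded[of p n]
        bounded_lines_mono[OF K(1), of 2 2 "enc_vars p n"] bounded_lines_mono[OF K(2), of 2 2 "enc_vars p n"]
      unfolding enc_system_def by blast
  qed (use p assms in auto)
  have "?R + ?r * length steps \<le> ?R + ?r * (2 * n + 1)"
    using len by (intro add_left_mono mult_le_mono2)
  ultimately obtain \<pi> where \<pi>: "sa_refutation (enc_vars p n) ?H \<pi>" "set \<pi> \<subseteq> L"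
    "length \<pi> \<le> (length steps + 1) * ((2 * (?R + ?r * (2 * n + 1)) + 1) * (S * (w + 4))) + 3"
    using refutation_from_steps[OF valid cancel f_def f_nonint] by blast
  note \<pi>(3)
  also have "(length steps + 1) * ((2 * (?R + ?r * (2 * n + 1)) + 1) * (S * (w + 4))) + 3 \<le>
      (2 * n + 2) * ((2 * (?R + ?r * (2 * n + 1)) + 1) * (S * (w + 4))) + 3"
    using len by (intro add_right_mono mult_le_mono1) simp
  finally show ?thesis
    using \<pi>(1,2) by blast
qed

lemma size_bound:
  fixes n p w :: nat
  assumes "2 \<le> p" "1 \<le> n" "1 \<le> w" "w \<le> n"
  shows "((2 * n + 2) * ((2 * ((n + 1) * p + (n + 1) * p\<^sup>2 * (2 * n + 1)) + 1) *
      (step_size p n w * (w + 4))) + 3) * ((n * p + 1)\<^sup>2 * step_size p n w * (w + 4))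
    \<le> 3918240 * (n * p ^ w) ^ 21"
\<comment> \<open>Every factor is compared with a power of v = n p^w, using p <= v and w <= n <= v.
  The length is at most 8163 v^12 and the size of a line at most 480 v^9, and their product is the
  stated bound.\<close>
proof -
  define v where "v = n * p ^ w"
  have pw: "p \<le> p ^ w"
    using assms power_increasing[of 1 w p] by simp
  have v1: "1 \<le> v"
    using mult_le_mono[of 1 n 1 "p ^ w"] assms by (simp add: v_def)
  have n: "n \<le> v" and q: "p ^ w \<le> v" and np: "n * p \<le> v"
    using mult_le_mono[of n n 1 "p ^ w"] mult_le_mono[of 1 n "p ^ w" "p ^ w"] pw assms
    by (auto simp: v_def)
  have p: "p \<le> v"
    using pw q by linarith
  have v_pow: "v ^ i \<le> v ^ j" if "i \<le> j" for i j
    using that v1 by (rule power_increasing)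
  have np1: "n * p + 1 \<le> 2 * v" and w4: "w + 4 \<le> 5 * v" and n1: "n + 1 \<le> 2 * v"
    using n np v1 assms(4) by linarith+
  have p2: "p\<^sup>2 \<le> v\<^sup>2"
    using p by (rule power_mono) simp
  have S: "step_size p n w \<le> 24 * v ^ 6"
  proof -
    have w2: "w + 2 \<le> 3 * v"
      using n v1 assms(4) by linarith
    have p2': "p\<^sup>2 + 1 \<le> 2 * v\<^sup>2"
      using p2 v_pow[of 0 2] unfolding power_0 by linarith
    have "step_size p n w \<le> (2 * v)\<^sup>2 * v * (3 * v) * (2 * v\<^sup>2)"
      unfolding step_size_def
      by (intro mult_le_mono power_mono q np1 w2 p2') simp
    also have "\<dots> = 24 * v ^ 6"
      by algebra
    finally show ?thesis .
  qed
  have M: "2 * ((n + 1) * p + (n + 1) * p\<^sup>2 * (2 * n + 1)) + 1 \<le> 17 * v ^ 4"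
  proof -
    have "(n + 1) * p \<le> (2 * v) * v"
      using n1 p by (rule mult_le_mono)
    also have "\<dots> \<le> 2 * v ^ 4"
      using v_pow[of 2 4] by (simp add: power2_eq_square)
    finally have 1: "(n + 1) * p \<le> 2 * v ^ 4" .
    have "(n + 1) * p\<^sup>2 * (2 * n + 1) \<le> (2 * v) * v\<^sup>2 * (3 * v)"
      using n1 p2 n v1 by (intro mult_le_mono) auto
    also have "\<dots> = 6 * v ^ 4"
      by algebra
    finally show ?thesis
      using 1 v_pow[of 0 4] by simp
  qed
  have "(2 * n + 2) * ((2 * ((n + 1) * p + (n + 1) * p\<^sup>2 * (2 * n + 1)) + 1) *
      (step_size p n w * (w + 4))) \<le> (4 * v) * (17 * v ^ 4 * (24 * v ^ 6 * (5 * v)))"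
    using M S w4 n1 by (intro mult_le_mono) auto
  also have "\<dots> = 8160 * v ^ 12"
    by algebra
  finally have len: "(2 * n + 2) * ((2 * ((n + 1) * p + (n + 1) * p\<^sup>2 * (2 * n + 1)) + 1) *
      (step_size p n w * (w + 4))) + 3 \<le> 8163 * v ^ 12"
    using v_pow[of 0 12] by simp
  have "(n * p + 1)\<^sup>2 * step_size p n w * (w + 4) \<le> (2 * v)\<^sup>2 * (24 * v ^ 6) * (5 * v)"
    using np1 S w4 by (intro mult_le_mono power_mono) auto
  also have "\<dots> = 480 * v ^ 9"
    by algebra
  finally have "((2 * n + 2) * ((2 * ((n + 1) * p + (n + 1) * p\<^sup>2 * (2 * n + 1)) + 1) *
      (step_size p n w * (w + 4))) + 3) * ((n * p + 1)\<^sup>2 * step_size p n w * (w + 4))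
    \<le> (8163 * v ^ 12) * (480 * v ^ 9)"
    using len by (rule mult_le_mono[rotated])
  also have "\<dots> = 3918240 * v ^ 21"
    by (simp add: power_add[symmetric])
  finally show ?thesis
    by (simp add: v_def)
qed

lemma bipoly_eval_monom: "bipoly_eval (monom (monom c k) k) x y = c * (x * y) ^ k"
  by (simp add: bipoly_eval_def poly_monom power_mult_distrib poly_power mult_ac)

text \<open>Without unknowns a violated row is encoded by the empty sum minus 1, so -1 is itself a
  hypothesis. This settles w = 0, where the steps with a single unknown would exceed the
  width.\<close>

lemma trivial_refutation:
  assumes "0 < p" "\<And>j. j \<in> {1..m} \<Longrightarrow> row_supp n (A j) = {}"
    and "\<not> lin_satisfiable p m n A b"
  shows "sa_refutation V (enc_system p m n A b \<union> G) [- 1]"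
proof -
  have A: "A j i = 0" if "j \<in> {1..m}" "i \<in> {1..n}" for i j
    using assms(2)[of j] that by (auto simp: row_supp_def)
  have "\<not> (\<forall>j\<in>{1..m}. [0 = b j] (mod p))"
    using assms(1,3) A by (auto simp: lin_satisfiable_def dest!: spec[of _ "\<lambda>_. 0"])
  then obtain j where j: "j \<in> {1..m}" "\<not> [0 = b j] (mod p)"
    by blast
  then have "- 1 \<in> enc_row p n (A j) (b j)"
    using assms(2)[OF j(1)] by (auto simp: enc_row_def)
  then have "- 1 \<in> enc_system p m n A b"
    using j(1) by (auto simp: enc_system_def)
  then show ?thesis
    by (simp add: sa_refutation_def sa_proof_def)
qed

theorem theorem2:
  shows "\<exists>(q :: real poly poly) (C :: nat).
    \<forall>(p::nat) (m::nat) (n::nat) (A :: nat \<Rightarrow> nat \<Rightarrow> nat) (b :: nat \<Rightarrow> nat) (w::nat).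
      prime p \<longrightarrow> m \<ge> 1 \<longrightarrow> n \<ge> 1 \<longrightarrow>
      (\<forall>j\<in>{1..m}. \<forall>i\<in>{1..n}. A j i < p) \<longrightarrow>
      (\<forall>j\<in>{1..m}. b j < p) \<longrightarrow>
      w = max_row_weight m n A \<longrightarrow>
      \<not> lin_satisfiable p m n A b \<longrightarrow>
      (\<exists>\<pi>. sa_refutation (enc_vars p n) (enc_system p m n A b \<union> enc_Z p n) \<pi> \<and>
           real (proof_size \<pi>) \<le> bipoly_eval q (real n) (real (p ^ w)) \<and>
           proof_degree \<pi> \<le> C * w + C)"
proof (intro exI[of _ "monom (monom 3918240 21) 21"] exI[of _ 4] allI impI)
  fix p m n w :: nat and A :: "nat \<Rightarrow> nat \<Rightarrow> nat" and b :: "nat \<Rightarrow> nat"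
  assume p: "prime p" and m: "m \<ge> 1" and n: "n \<ge> 1"
    and A: "\<forall>j\<in>{1..m}. \<forall>i\<in>{1..n}. A j i < p" and b: "\<forall>j\<in>{1..m}. b j < p"
    and w: "w = max_row_weight m n A" and unsat: "\<not> lin_satisfiable p m n A b"
  let ?H = "enc_system p m n A b \<union> enc_Z p n" and ?V = "enc_vars p n"
  \<comment> \<open>The polynomial 3918240 (x y)^21, so that its value at n and p^w is the bound of
    \<open>size_bound\<close>. The constant 4 in the degree bound suffices because w + 4 <= 4 w +
    4.\<close>
  let ?q = "monom (monom 3918240 21) 21 :: real poly poly"
  have p2: "2 \<le> p"
    using p by (rule prime_ge_2_nat)
  have row_le: "card (row_supp n (A j)) \<le> w" if "j \<in> {1..m}" for j
    unfolding w max_row_weight_def using that by (intro Max_ge) auto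
  have fin: "finite (row_supp n (A j))" for j
    by (simp add: row_supp_def)
  have w_le: "w \<le> n"
    unfolding w max_row_weight_def using m card_row_supp by (subst Max_le_iff) auto
  show "\<exists>\<pi>. sa_refutation ?V ?H \<pi> \<and> real (proof_size \<pi>) \<le> bipoly_eval ?q (real n) (real (p ^ w)) \<and>
      proof_degree \<pi> \<le> 4 * w + 4"
  proof (cases "w = 0")
    case True
    then have "sa_refutation ?V ?H [- 1]"
      using row_le fin p2 unsat by (intro trivial_refutation) auto
    moreover have "proof_size [- 1 :: enc_var rpoly] = 0" "proof_degree [- 1 :: enc_var rpoly] = 0"
      by (simp_all add: proof_size_def proof_degree_def poly_size_def total_degree_def)
    ultimately show ?thesis
      by (intro exI[of _ "[- 1]"]) (simp add: bipoly_eval_monom)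
  next
    case False
    let ?K = "(n * p + 1)\<^sup>2 * step_size p n w"
    let ?N = "(2 * n + 2) *
      ((2 * ((n + 1) * p + (n + 1) * p\<^sup>2 * (2 * n + 1)) + 1) * (step_size p n w * (w + 4))) + 3"
    obtain \<pi> where \<pi>: "sa_refutation ?V ?H \<pi>" "set \<pi> \<subseteq> bounded_lines ?V ?K (w + 4)" "length \<pi> \<le> ?N"
      using refutation_exists[of p n w m A b] p n False A b row_le unsat by auto
    have "proof_size \<pi> \<le> length \<pi> * (?K * (w + 4))"
      using \<pi>(2) by (rule proof_size_bounded_lines)
    also have "\<dots> \<le> ?N * (?K * (w + 4))"
      using \<pi>(3) by (rule mult_le_mono1)
    also have "\<dots> \<le> 3918240 * (n * p ^ w) ^ 21"
      using p2 n False w_le by (intro size_bound) auto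
    finally have "real (proof_size \<pi>) \<le> real (3918240 * (n * p ^ w) ^ 21)"
      by (simp only: of_nat_le_iff)
    also have "\<dots> = bipoly_eval ?q (real n) (real (p ^ w))"
      by (simp add: bipoly_eval_monom)
    finally have "real (proof_size \<pi>) \<le> bipoly_eval ?q (real n) (real (p ^ w))" .
    moreover have "proof_degree \<pi> \<le> 4 * w + 4"
      using proof_degree_bounded_lines[OF \<pi>(2)] by simp
    ultimately show ?thesis
      using \<pi>(1) by blast
  qed
qed

end
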